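(* Let $\Theta=(\mathcal{P},\Sigma)$ be a singular partition on a smooth manifold $M$, and let $Z\subset M$ be a closed subset such that every $z\in Z$ is a singular element of $\Theta$, i.e. $\{z\}\in\Sigma$. Suppose that $\Theta$ has an invariant $\infty$-contraction to $Z$ defined on a $\Theta$-invariant neighbourhood $V$ of $Z$. Let $h\in\mathcal{E}(\Theta,V)$ be a map fixed outside some neighbourhood $U$ of $Z$ such that $\overline{U}\subset\mathrm{Int}\,V$ (i.e. $h(x)=x$ for all $x\in V\setminus U$). Then $h\in\mathcal{E}_{\mathrm{id}}(\Theta,V)^{0}$. However, $h$ does not necessarily belong to $\mathcal{E}_{\mathrm{id}}(\Theta,V)^{r}$ for $r\ge1$: there exist a smooth manifold $M$, a singular partition $\Theta=(\mathcal{P},\Sigma)$ on $M$, a closed subset $Z\subset M$ with $\{z\}\in\Sigma$ for every $z\in Z$, a $\Theta$-invariant neighbourhood $V$ of $Z$ on which an invariant $\infty$-contraction of $\Theta$ to $Z$ is defined, and a map $h\in\mathcal{E}(\Theta,V)$ fixed outside some neighbourhood $U$ of $Z$ with $\overline{U}\subset\mathrm{Int}\,V$, such that $h\notin\mathcal{E}_{\mathrm{id}}(\Theta,V)^{r}$ for some $r\geq 1$.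
   Context: Singular partition: a partition $\mathcal{P}=\{\omega_i\}_{i\in\Lambda}$ of $M$ into pairwise disjoint subsets covering $M$ (with $\Lambda$ arbitrary, $\omega_i$ not necessarily closed), together with a (possibly empty) subfamily $\Sigma\subset\mathcal{P}$ of "singular" elements; $\Theta=(\mathcal{P},\Sigma)$. A subset $V\subset M$ is $\Theta$-invariant if $\omega\in\mathcal{P}$ and $\omega\cap V\neq\varnothing$ imply $\omega\subset V$. $\mathcal{E}(\Theta,V)$ is the set of $C^\infty$ maps $g:V\to M$ such that (1) $g(\omega\cap V)\subset\omega$ for all $\omega\in\mathcal{P}$, and (2) $g$ is a local diffeomorphism at every point $z\in V$ belonging to some $\omega\in\Sigma$ (at boundary points of $V$: the tangent map is invertible). For $r\in\{0,1,2,\dots,\infty\}$, $\mathcal{E}_{\mathrm{id}}(\Theta,V)^{r}$ is the path-component of the inclusion $i_V:V\subset M$ in $\mathcal{E}(\Theta,V)$ with respect to the weak Whitney $C^r_W$-topology. Thus it consists of those $g\in\mathcal{E}(\Theta,V)$ for which there is an $r$-homotopy $H:V\times[0,1]\to M$ from $i_V$ to $g$ with all $H_t\in\mathcal{E}(\Theta,V)$; here a homotopy $H$ is an $r$-homotopy if each $H_t$ is $C^r$ and, in local coordinates, all partial derivatives of $H(x,t)$ in $x$ of order at most $r$ depend continuously on $(x,t)$. A $0$-homotopy is a usual homotopy. Invariant $r$-contraction to $Z$ (where $Z$ is closed and $\{z\}\in\Sigma$ for all $z\in Z$): $\Theta$ has one if there exist a closed $\Theta$-invariant neighbourhood $V$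 of $Z$ that is a smooth submanifold of $M$ and a homotopy $\rho:V\times[0,1]\to V$ such that: (i) $\rho_1=\mathrm{id}_V$; (ii) $\rho_0$ is a proper retraction of $V$ onto $Z$, i.e. $\rho_0(V)=Z$, $\rho_0(z)=z$ for $z\in Z$, and $\rho_0^{-1}(K)$ is compact for every compact $K\subset Z$; (iii) for every $t\in(0,1]$ the map $\rho_t$ is a closed $C^r$-embedding of $V$ into $V$ such that for each $\omega\in\mathcal{P}$ (resp. $\omega\in\Sigma$) contained in $V$ its image $\rho_t(\omega)$ is also an element of $\mathcal{P}$ (resp. $\Sigma$); (iv) for each $z\in Z$ the set $V_z=\rho_0^{-1}(z)$ is $\Theta$-invariant and $\rho_t(V_z)\subset V_z$ for all $t\in[0,1]$.
   Formalization: In condition (iii) of the invariant contraction, each embedding ρ_t (t>0) is also required to send non-singular elements of P contained in V to non-singular elements; with only P to P and Σ to Σ the first claim is false. *)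

theory Defs
  imports "HOL-Analysis.Analysis" "HOL-Library.Extended_Nat" "HOL-Library.Disjoint_Sets"
begin

text \<open>
  Maps between manifolds are studied through their coordinate representatives. All derivatives
  are taken \<open>within\<close> the coordinate domain, so that the same notions apply at the boundary points
  of a codimension zero submanifold, where the derivative within the set is still unique.
\<close>

primrec Ck_on ::
  "nat \<Rightarrow> 'b::real_normed_vector set \<Rightarrow> ('b \<Rightarrow> 'c::real_normed_vector) \<Rightarrow> bool" where
  "Ck_on 0 D f \<longleftrightarrow> continuous_on D f"
| "Ck_on (Suc k) D f \<longleftrightarrow>
     (\<exists>f'. (\<forall>x\<in>D. (f has_derivative f' x) (at x within D)) \<and> (\<forall>v. Ck_on k D (\<lambda>x. f' x v)))"

definition Cr_on ::
  "enat \<Rightarrow> 'b::real_normed_vector set \<Rightarrow> ('b \<Rightarrow> 'c::real_normed_vector) \<Rightarrow> bool" where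
  "Cr_on r D f \<longleftrightarrow> (\<forall>k. enat k \<le> r \<longrightarrow> Ck_on k D f)"

text \<open>The iterated partial derivative of \<open>f\<close> in the directions listed.\<close>

primrec partial_deriv ::
  "'b list \<Rightarrow> 'b::real_normed_vector set \<Rightarrow> ('b \<Rightarrow> 'c::real_normed_vector) \<Rightarrow> 'b \<Rightarrow> 'c" where
  "partial_deriv [] D f = f"
| "partial_deriv (v # vs) D f = partial_deriv vs D (\<lambda>x. frechet_derivative f (at x within D) v)"


section \<open>Smooth manifolds\<close>

text \<open>
  A manifold is a topology \<open>M\<close> on a set of points together with a maximal smooth atlas \<open>A\<close>, whose
  members are pairs \<open>(U, \<phi>)\<close>; only the values of \<open>\<phi>\<close> on \<open>U\<close> matter. The model space is
  the type \<open>'b\<close> of coordinates. As the dimension of a \<open>euclidean_space\<close> type is positive,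
  zero-dimensional manifolds are included by admitting \<open>{0}\<close> as a model space as well.
\<close>

type_synonym ('a, 'b) chart = "'a set \<times> ('a \<Rightarrow> 'b)"

definition is_chart ::
  "'a topology \<Rightarrow> 'b::euclidean_space set \<Rightarrow> ('a, 'b) chart \<Rightarrow> bool" where
  "is_chart M E = (\<lambda>(U, \<phi>). openin M U \<and> openin (top_of_set E) (\<phi> ` U) \<and>
     homeomorphic_map (subtopology M U) (top_of_set (\<phi> ` U)) \<phi>)"

definition smooth_transition ::
  "('a, 'b::euclidean_space) chart \<Rightarrow> ('a, 'b) chart \<Rightarrow> bool" where
  "smooth_transition = (\<lambda>(U, \<phi>) (W, \<psi>). Cr_on \<infinity> (\<phi> ` (U \<inter> W)) (\<psi> \<circ> inv_into U \<phi>))"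

definition compatible ::
  "('a, 'b::euclidean_space) chart \<Rightarrow> ('a, 'b) chart \<Rightarrow> bool" where
  "compatible c d \<longleftrightarrow> smooth_transition c d \<and> smooth_transition d c"

definition second_countable_topology_on :: "'a topology \<Rightarrow> bool" where
  "second_countable_topology_on M \<longleftrightarrow>
     (\<exists>\<B>. countable \<B> \<and> (\<forall>B\<in>\<B>. openin M B) \<and> (\<forall>W. openin M W \<longrightarrow> (\<exists>\<U>\<subseteq>\<B>. W = \<Union>\<U>)))"

definition smooth_manifold ::
  "'a topology \<Rightarrow> ('a, 'b::euclidean_space) chart set \<Rightarrow> bool" where
  "smooth_manifold M A \<longleftrightarrow>
     Hausdorff_space M \<and> second_countable_topology_on M \<and>
     (\<exists>E. (E = UNIV \<or> E = {0}) \<and>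
        (\<forall>c\<in>A. is_chart M E c) \<and>
        (\<Union>c\<in>A. fst c) = topspace M \<and>
        (\<forall>c\<in>A. \<forall>d\<in>A. compatible c d) \<and>
        (\<forall>c. is_chart M E c \<and> (\<forall>d\<in>A. compatible c d) \<longrightarrow> c \<in> A))"

text \<open>
  Submanifolds may have boundary: in a suitable chart, \<open>V\<close> is a linear subspace (the case
  where \<open>e\<close> is orthogonal to \<open>S\<close>) or a closed half-space of a linear subspace.
\<close>

definition submanifold ::
  "('a, 'b::euclidean_space) chart set \<Rightarrow> 'a set \<Rightarrow> bool" where
  "submanifold A V \<longleftrightarrow>
     (\<forall>p\<in>V. \<exists>(U, \<phi>)\<in>A. p \<in> U \<and>
        (\<exists>S e. subspace S \<and> \<phi> ` (U \<inter> V) = \<phi> ` U \<inter> {x\<in>S. 0 \<le> e \<bullet> x}))"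


section \<open>Maps from a subset of the manifold into the manifold\<close>

definition coord_dom ::
  "'a set \<Rightarrow> ('a \<Rightarrow> 'a) \<Rightarrow> ('a, 'b::euclidean_space) chart \<Rightarrow> ('a, 'b) chart \<Rightarrow> 'b set" where
  "coord_dom V g = (\<lambda>(U, \<phi>) (W, \<psi>). \<phi> ` {x\<in>V \<inter> U. g x \<in> W})"

definition coord_map ::
  "('a \<Rightarrow> 'a) \<Rightarrow> ('a, 'b::euclidean_space) chart \<Rightarrow> ('a, 'b) chart \<Rightarrow> 'b \<Rightarrow> 'b" where
  "coord_map g = (\<lambda>(U, \<phi>) (W, \<psi>). \<psi> \<circ> g \<circ> inv_into U \<phi>)"

definition Cr_map ::
  "'a topology \<Rightarrow> ('a, 'b::euclidean_space) chart set \<Rightarrow> enat \<Rightarrow> 'a set \<Rightarrow> ('a \<Rightarrow> 'a) \<Rightarrow> bool" where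
  "Cr_map M A r V g \<longleftrightarrow>
     continuous_map (subtopology M V) M g \<and>
     (\<forall>c\<in>A. \<forall>d\<in>A. Cr_on r (coord_dom V g c d) (coord_map g c d))"

text \<open>\<open>D\<close> represents the tangent map of \<open>g\<close> at \<open>z\<close> in some pair of charts.\<close>

definition tangent_map ::
  "('a, 'b::euclidean_space) chart set \<Rightarrow> 'a set \<Rightarrow> ('a \<Rightarrow> 'a) \<Rightarrow> 'a \<Rightarrow> ('b \<Rightarrow> 'b) \<Rightarrow> bool" where
  "tangent_map A V g z D \<longleftrightarrow>
     (\<exists>c\<in>A. \<exists>d\<in>A. z \<in> fst c \<and> g z \<in> fst d \<and>
        (coord_map g c d has_derivative D) (at (snd c z) within coord_dom V g c d))"

definition local_diffeo_at ::
  "'a topology \<Rightarrow> ('a, 'b::euclidean_space) chart set \<Rightarrow> 'a set \<Rightarrow> ('a \<Rightarrow> 'a) \<Rightarrow> 'a \<Rightarrow> bool" where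
  "local_diffeo_at M A V g z \<longleftrightarrow>
     (if z \<in> M interior_of V
      then \<exists>N. openin M N \<and> z \<in> N \<and> N \<subseteq> V \<and> openin M (g ` N) \<and> inj_on g N \<and>
               Cr_map M A \<infinity> N g \<and> Cr_map M A \<infinity> (g ` N) (inv_into N g)
      else \<exists>D. tangent_map A V g z D \<and> bij D)"

definition closed_Cr_embedding ::
  "'a topology \<Rightarrow> ('a, 'b::euclidean_space) chart set \<Rightarrow> enat \<Rightarrow> 'a set \<Rightarrow> ('a \<Rightarrow> 'a) \<Rightarrow> bool" where
  "closed_Cr_embedding M A r V g \<longleftrightarrow>
     g ` V \<subseteq> V \<and> Cr_map M A r V g \<and>
     embedding_map (subtopology M V) (subtopology M V) g \<and>
     closedin (subtopology M V) (g ` V) \<and>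
     (1 \<le> r \<longrightarrow> (\<forall>z\<in>V. \<exists>D. tangent_map A V g z D \<and> inj D))"


section \<open>The weak Whitney topology\<close>

text \<open>Maps on \<open>V\<close> are represented by functions that are \<open>undefined\<close> outside \<open>V\<close>.\<close>

definition Cr_maps ::
  "'a topology \<Rightarrow> ('a, 'b::euclidean_space) chart set \<Rightarrow> enat \<Rightarrow> 'a set \<Rightarrow> ('a \<Rightarrow> 'a) set" where
  "Cr_maps M A r V = {g \<in> V \<rightarrow>\<^sub>E topspace M. Cr_map M A r V g}"

definition Whitney_nbhd ::
  "'a topology \<Rightarrow> ('a, 'b::euclidean_space) chart set \<Rightarrow> enat \<Rightarrow> 'a set \<Rightarrow> ('a \<Rightarrow> 'a) \<Rightarrow>
   ('a, 'b) chart \<Rightarrow> ('a, 'b) chart \<Rightarrow> 'a set \<Rightarrow> nat \<Rightarrow> real \<Rightarrow> ('a \<Rightarrow> 'a) set" where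
  "Whitney_nbhd M A r V f c d K k \<epsilon> =
     {g \<in> Cr_maps M A r V. g ` K \<subseteq> fst d \<and>
        (\<forall>vs. set vs \<subseteq> Basis \<and> length vs \<le> k \<longrightarrow>
          (\<forall>x\<in>K. norm (partial_deriv vs (coord_dom V f c d) (coord_map f c d) (snd c x) -
                       partial_deriv vs (coord_dom V g c d) (coord_map g c d) (snd c x)) < \<epsilon>))}"

text \<open>
  For \<open>r = \<infinity>\<close> this is the topology generated by those induced from the weak \<open>C\<^sup>k\<close>
  topologies for all finite \<open>k\<close>.
\<close>

definition weak_Whitney_topology ::
  "'a topology \<Rightarrow> ('a, 'b::euclidean_space) chart set \<Rightarrow> enat \<Rightarrow> 'a set \<Rightarrow> ('a \<Rightarrow> 'a) topology" where
  "weak_Whitney_topology M A r V = topology_generated_by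
     (insert (Cr_maps M A r V)
       {Whitney_nbhd M A r V f c d K k \<epsilon> | f c d K k \<epsilon>.
          f \<in> Cr_maps M A r V \<and> c \<in> A \<and> d \<in> A \<and> compactin M K \<and> K \<subseteq> V \<inter> fst c \<and>
          f ` K \<subseteq> fst d \<and> enat k \<le> r \<and> 0 < \<epsilon>})"


section \<open>Singular partitions\<close>

definition singular_partition :: "'a topology \<Rightarrow> 'a set set \<Rightarrow> 'a set set \<Rightarrow> bool" where
  "singular_partition M \<P> \<Sigma> \<longleftrightarrow> partition_on (topspace M) \<P> \<and> \<Sigma> \<subseteq> \<P>"

definition invariant_set :: "'a topology \<Rightarrow> 'a set set \<Rightarrow> 'a set \<Rightarrow> bool" where
  "invariant_set M \<P> V \<longleftrightarrow> V \<subseteq> topspace M \<and> (\<forall>\<omega>\<in>\<P>. \<omega> \<inter> V \<noteq> {} \<longrightarrow> \<omega> \<subseteq> V)"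

definition \<E> ::
  "'a topology \<Rightarrow> ('a, 'b::euclidean_space) chart set \<Rightarrow> 'a set set \<Rightarrow> 'a set set \<Rightarrow> 'a set \<Rightarrow>
   ('a \<Rightarrow> 'a) set" where
  "\<E> M A \<P> \<Sigma> V =
     {g \<in> Cr_maps M A \<infinity> V. (\<forall>\<omega>\<in>\<P>. g ` (\<omega> \<inter> V) \<subseteq> \<omega>) \<and>
        (\<forall>\<omega>\<in>\<Sigma>. \<forall>z\<in>\<omega> \<inter> V. local_diffeo_at M A V g z)}"

definition \<E>_id ::
  "'a topology \<Rightarrow> ('a, 'b::euclidean_space) chart set \<Rightarrow> 'a set set \<Rightarrow> 'a set set \<Rightarrow> 'a set \<Rightarrow>
   enat \<Rightarrow> ('a \<Rightarrow> 'a) set" where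
  "\<E>_id M A \<P> \<Sigma> V r =
     path_component_of_set (subtopology (weak_Whitney_topology M A r V) (\<E> M A \<P> \<Sigma> V)) (\<lambda>x\<in>V. x)"

text \<open>
  The embeddings \<open>\<rho> t\<close> preserve the kind of an element: regular elements go to regular
  elements and singular ones to singular ones. Were regular elements only required to go to
  elements of \<open>\<P>\<close>, conjugation by \<open>\<rho> t\<close> would not preserve \<open>\<E>\<close>: it could turn a map that fails to be
  a local diffeomorphism on a regular element into one that fails to be so on a singular element.
\<close>

definition invariant_contraction ::
  "'a topology \<Rightarrow> ('a, 'b::euclidean_space) chart set \<Rightarrow> 'a set set \<Rightarrow> 'a set set \<Rightarrow> enat \<Rightarrow>
   'a set \<Rightarrow> 'a set \<Rightarrow> bool" where
  "invariant_contraction M A \<P> \<Sigma> r Z V \<longleftrightarrow>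
     closedin M V \<and> invariant_set M \<P> V \<and> Z \<subseteq> M interior_of V \<and> submanifold A V \<and>
     (\<exists>\<rho> :: real \<Rightarrow> 'a \<Rightarrow> 'a.
        continuous_map (prod_topology (subtopology M V) (top_of_set {0..1})) (subtopology M V)
          (\<lambda>(x, t). \<rho> t x) \<and>
        (\<forall>x\<in>V. \<rho> 1 x = x) \<and>
        \<rho> 0 ` V = Z \<and> (\<forall>z\<in>Z. \<rho> 0 z = z) \<and>
        (\<forall>K\<subseteq>Z. compactin M K \<longrightarrow> compactin M {x\<in>V. \<rho> 0 x \<in> K}) \<and>
        (\<forall>t\<in>{0<..1}. closed_Cr_embedding M A r V (\<rho> t) \<and>
           (\<forall>\<omega>\<in>\<P> - \<Sigma>. \<omega> \<subseteq> V \<longrightarrow> \<rho> t ` \<omega> \<in> \<P> - \<Sigma>) \<and>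
           (\<forall>\<omega>\<in>\<Sigma>. \<omega> \<subseteq> V \<longrightarrow> \<rho> t ` \<omega> \<in> \<Sigma>)) \<and>
        (\<forall>z\<in>Z. invariant_set M \<P> {x\<in>V. \<rho> 0 x = z} \<and>
           (\<forall>t\<in>{0..1}. \<rho> t ` {x\<in>V. \<rho> 0 x = z} \<subseteq> {x\<in>V. \<rho> 0 x = z})))"

text \<open>\<open>U\<close> is a neighbourhood of \<open>Z\<close>, not necessarily open.\<close>

definition fixed_outside_nbhd ::
  "'a topology \<Rightarrow> 'a set \<Rightarrow> 'a set \<Rightarrow> ('a \<Rightarrow> 'a) \<Rightarrow> bool" where
  "fixed_outside_nbhd M Z V h \<longleftrightarrow>
     (\<exists>U\<subseteq>topspace M. Z \<subseteq> M interior_of U \<and> M closure_of U \<subseteq> M interior_of V \<and>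
        (\<forall>x\<in>V - U. h x = x))"

end

theory Submission
  imports Defs
begin

text \<open>
  The first part is the Alexander trick: conjugate \<open>h\<close> by the embedding \<open>\<rho> t\<close> on the image of
  \<open>\<rho> t\<close> and take the identity elsewhere. As \<open>\<rho> t\<close> preserves the partition together with
  its singular elements, this stays in \<open>\<E>\<close>. As \<open>h\<close> preserves the compact fibres of \<open>\<rho> 0\<close>,
  which \<open>\<rho> t\<close> contracts to points, the family extends continuously by the identity to
  \<open>t = 0\<close> in the \<open>C\<^sup>0\<close> topology.

  Conjugation by a dilation does not change the tangent map at a fixed point, so nothing of the
  kind can be expected for \<open>r \<ge> 1\<close>. In the plane, take the level sets of the quartic
  \<open>x\<^sup>4 + y\<^sup>4\<close> and a twist along them that is \<open>w \<mapsto> - w\<close> near 0 and the identity further out.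
  The tangent map at 0 of an element of \<open>\<E>\<close> is a linear symmetry of the quartic. There are
  finitely many of these, so no path in the \<open>C\<^sup>1\<close> topology leads from the identity to the twist.
\<close>

section \<open>Maps of class \<open>C\<^sup>k\<close>\<close>

text \<open>The conjugation is carried out only over the image of the interior of \<open>V\<close>.
  By invariance of domain this image is open in the manifold, so the inverse function theorem
  applies to \<open>\<rho> t\<close> there without meeting boundary points. As the closure of
  \<open>U\<close> lies in the interior of \<open>V\<close>, the conjugate merges with the identity
  before the boundary of that image is reached. For continuity in time, openness at each fixed
  \<open>t\<close> is too weak: the set of all pairs \<open>(x, t)\<close> with \<open>x\<close> in
  the moving image has to be open. At \<open>t = 0\<close> the inverse of \<open>\<rho> t\<close>
  degenerates altogether, so continuity is read off from graphs over compact sets and not from the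
  formula for the conjugate.

  The degree in the counterexample matters. For \<open>x\<^sup>2 + y\<^sup>2\<close> every rotation
  is a symmetry, and reducing the angle of the twist would join it smoothly to the identity. In
  degree 4 the mixed terms rule out all linear symmetries except signed permutations of the
  coordinates. The half turn is one of them, so a twist may be \<open>- w\<close> at the centre,
  although the rotations through which it is reached are not symmetries.\<close>

lemma Ck_on_mono: "Ck_on k D f \<Longrightarrow> D' \<subseteq> D \<Longrightarrow> Ck_on k D' f"
proof (induction k arbitrary: f)
  case 0
  then show ?case by (auto intro: continuous_on_subset)
next
  case (Suc k)
  then obtain f' where "\<forall>x\<in>D. (f has_derivative f' x) (at x within D)" "\<forall>v. Ck_on k D (\<lambda>x. f' x v)"
    by auto
  with Suc show ?case
    by (auto intro!: exI[of _ f'] intro: has_derivative_subset)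
qed

lemma Ck_on_cong:
  assumes "Ck_on k D f" "\<And>x. x \<in> D \<Longrightarrow> f x = g x"
  shows "Ck_on k D g"
proof (cases k)
  case 0
  then show ?thesis using assms continuous_on_cong by force
next
  case (Suc n)
  with assms obtain f' where "\<forall>x\<in>D. (f has_derivative f' x) (at x within D)" "\<forall>v. Ck_on n D (\<lambda>x. f' x v)"
    by auto
  with Suc assms(2) show ?thesis
    by (auto intro!: exI[of _ f'] intro: has_derivative_transform[of _ D g f])
qed

lemma Ck_on_continuous: "Ck_on k D f \<Longrightarrow> continuous_on D f"
proof (cases k)
  case (Suc n)
  then show "Ck_on k D f \<Longrightarrow> continuous_on D f"
    by (auto simp: continuous_on_eq_continuous_within intro: has_derivative_continuous)
qed auto

lemma Ck_on_Suc_imp: "Ck_on (Suc k) D f \<Longrightarrow> Ck_on k D f"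
proof (induction k arbitrary: f)
  case 0
  then show ?case using Ck_on_continuous[of "Suc 0"] by simp
next
  case (Suc k)
  then show ?case by (metis Ck_on.simps(2))
qed

lemma Ck_on_const: "Ck_on k D (\<lambda>x. c)"
proof (induction k arbitrary: c)
  case (Suc k)
  then show ?case by (auto intro!: exI[of _ "\<lambda>x v. 0"])
qed auto

lemma Ck_on_bounded_linear: "bounded_linear f \<Longrightarrow> Ck_on k D f"
proof (cases k)
  case 0
  assume "bounded_linear f"
  then show ?thesis using 0 by (simp add: linear_continuous_on)
next
  case (Suc n)
  assume "bounded_linear f"
  then show ?thesis using Suc
    by (auto intro!: exI[of _ "\<lambda>x. f"] Ck_on_const bounded_linear_imp_has_derivative)
qed

lemma Ck_on_add: "Ck_on k D f \<Longrightarrow> Ck_on k D g \<Longrightarrow> Ck_on k D (\<lambda>x. f x + g x)"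
proof (induction k arbitrary: f g)
  case 0
  then show ?case by (auto intro: continuous_on_add)
next
  case (Suc k)
  then obtain f' g' where "\<forall>x\<in>D. (f has_derivative f' x) (at x within D)" "\<forall>v. Ck_on k D (\<lambda>x. f' x v)"
    "\<forall>x\<in>D. (g has_derivative g' x) (at x within D)" "\<forall>v. Ck_on k D (\<lambda>x. g' x v)"
    by auto
  with Suc.IH show ?case
    by (auto intro!: exI[of _ "\<lambda>x v. f' x v + g' x v"] has_derivative_add)
qed

lemma Ck_on_sum: "finite I \<Longrightarrow> (\<And>i. i \<in> I \<Longrightarrow> Ck_on k D (f i)) \<Longrightarrow> Ck_on k D (\<lambda>x. \<Sum>i\<in>I. f i x)"
  by (induction I rule: finite_induct) (auto intro: Ck_on_const Ck_on_add)

lemma Ck_on_bounded_bilinear: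
  assumes "bounded_bilinear p"
  shows "Ck_on k D f \<Longrightarrow> Ck_on k D g \<Longrightarrow> Ck_on k D (\<lambda>x. p (f x) (g x))"
proof (induction k arbitrary: f g)
  case 0
  then show ?case using assms by (auto intro: bounded_bilinear.continuous_on)
next
  case (Suc k)
  then obtain f' g' where "\<forall>x\<in>D. (f has_derivative f' x) (at x within D)" "\<forall>v. Ck_on k D (\<lambda>x. f' x v)"
    "\<forall>x\<in>D. (g has_derivative g' x) (at x within D)" "\<forall>v. Ck_on k D (\<lambda>x. g' x v)"
    by auto
  moreover have "Ck_on k D f" "Ck_on k D g" using Suc.prems Ck_on_Suc_imp by auto
  ultimately show ?case using assms Suc.IH
    by (auto intro!: exI[of _ "\<lambda>x v. p (f x) (g' x v) + p (f' x v) (g x)"] bounded_bilinear.FDERIV Ck_on_add)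
qed

lemmas Ck_on_scaleR = Ck_on_bounded_bilinear[OF bounded_bilinear_scaleR]
lemmas Ck_on_mult = Ck_on_bounded_bilinear[OF bounded_bilinear_mult]

lemma Ck_on_bounded_linear_comp:
  assumes "bounded_linear L" shows "Ck_on k D f \<Longrightarrow> Ck_on k D (\<lambda>x. L (f x))"
proof (induction k arbitrary: f)
  case 0
  then show ?case using assms by (auto intro: bounded_linear.continuous_on)
next
  case (Suc k)
  then obtain f' where "\<forall>x\<in>D. (f has_derivative f' x) (at x within D)" "\<forall>v. Ck_on k D (\<lambda>x. f' x v)"
    by auto
  with Suc assms show ?case
    by (auto intro!: exI[of _ "\<lambda>x v. L (f' x v)"] intro: bounded_linear.has_derivative)
qed

lemmas Ck_on_minus = Ck_on_bounded_linear_comp[OF bounded_linear_minus[OF bounded_linear_ident]]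

lemma linear_expand:
  fixes L :: "'b::euclidean_space \<Rightarrow> 'c::real_vector"
  assumes "linear L" shows "L v = (\<Sum>b\<in>Basis. (v \<bullet> b) *\<^sub>R L b)"
proof -
  have "L v = L (\<Sum>b\<in>Basis. (v \<bullet> b) *\<^sub>R b)" by (simp add: euclidean_representation)
  also have "\<dots> = (\<Sum>b\<in>Basis. (v \<bullet> b) *\<^sub>R L b)"
    by (simp add: linear_sum[OF assms] linear_cmul[OF assms])
  finally show ?thesis .
qed

text \<open>Expanding \<open>v x\<close> in the orthonormal basis gives a finite sum of scalar
  coordinates times the maps \<open>L x b\<close>. The chain rule and the derivative of inversion
  both produce terms of this shape, in which a linear map and its argument vary together.\<close>

lemma Ck_on_apply_linear:
  fixes L :: "'a::real_normed_vector \<Rightarrow> 'b::euclidean_space \<Rightarrow> 'c::real_normed_vector"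
  assumes "\<And>x. x \<in> D \<Longrightarrow> linear (L x)" "\<And>b. Ck_on k D (\<lambda>x. L x b)" "Ck_on k D v"
  shows "Ck_on k D (\<lambda>x. L x (v x))"
proof (rule Ck_on_cong)
  show "Ck_on k D (\<lambda>x. \<Sum>b\<in>Basis. (v x \<bullet> b) *\<^sub>R L x b)"
    by (intro Ck_on_sum Ck_on_scaleR assms finite_Basis Ck_on_bounded_linear_comp[OF bounded_linear_inner_left])
qed (use linear_expand[OF assms(1)] in auto)

text \<open>The derivative in direction \<open>v\<close> is \<open>g' (f x) (f' x v)\<close>. The
  induction hypothesis for each \<open>\<lambda>y. g' y b\<close> controls the linear map, and
  \<open>Ck_on_apply_linear\<close> combines it with the moving argument
  \<open>f' x v\<close>.\<close>

lemma Ck_on_compose: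
  fixes f :: "'a::real_normed_vector \<Rightarrow> 'b::euclidean_space"
  assumes "f ` D \<subseteq> D'"
  shows "Ck_on k D f \<Longrightarrow> Ck_on k D' g \<Longrightarrow> Ck_on k D (\<lambda>x. g (f x))"
  using assms
proof (induction k arbitrary: g)
  case 0
  then show ?case by (auto intro: continuous_on_compose2)
next
  case (Suc k)
  then obtain f' g' where f': "\<forall>x\<in>D. (f has_derivative f' x) (at x within D)" "\<forall>v. Ck_on k D (\<lambda>x. f' x v)"
    and g': "\<forall>x\<in>D'. (g has_derivative g' x) (at x within D')" "\<forall>v. Ck_on k D' (\<lambda>x. g' x v)"
    by auto
  have der: "((\<lambda>x. g (f x)) has_derivative (\<lambda>v. g' (f x) (f' x v))) (at x within D)" if "x \<in> D" for x
    using has_derivative_in_compose2[of D' g g' f D x "f' x"] f' g' that Suc.prems by auto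
  have "Ck_on k D (\<lambda>x. g' (f x) (f' x v))" for v
  proof (rule Ck_on_apply_linear)
    show "linear (g' (f x))" if "x \<in> D" for x
      using g'(1) that Suc.prems by (meson has_derivative_linear image_subset_iff)
    show "Ck_on k D (\<lambda>x. g' (f x) b)" for b
      using Suc.IH[of "\<lambda>y. g' y b"] g'(2) Suc.prems Ck_on_Suc_imp by blast
  qed (use f' in auto)
  with der show ?case by (auto intro!: exI[of _ "\<lambda>x v. g' (f x) (f' x v)"])
qed

text \<open>Derivatives within a non-open set need not be unique, so pieces may only be glued along open
  overlaps.\<close>

lemma Ck_on_glue:
  fixes f :: "'a::euclidean_space \<Rightarrow> 'c::real_normed_vector"
  assumes "open D1" "D1 \<subseteq> D" "openin (top_of_set D) D2" "D = D1 \<union> D2"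
  shows "Ck_on k D1 f \<Longrightarrow> Ck_on k D2 f \<Longrightarrow> Ck_on k D f"
proof (induction k arbitrary: f)
  case 0
  have "openin (top_of_set D) D1" using assms by (simp add: open_subset)
  then show ?case
    using 0 assms continuous_on_Un_local_open[of D1 D2 f] by simp
next
  case (Suc k)
  then obtain f1 f2 where f1: "\<forall>x\<in>D1. (f has_derivative f1 x) (at x within D1)" "\<forall>v. Ck_on k D1 (\<lambda>x. f1 x v)"
    and f2: "\<forall>x\<in>D2. (f has_derivative f2 x) (at x within D2)" "\<forall>v. Ck_on k D2 (\<lambda>x. f2 x v)"
    by auto
  obtain T where T: "open T" "D2 = D \<inter> T" using assms(3) by (auto simp: openin_open)
  \<comment> \<open>The two derivatives are taken within different sets, but both restrict to the
    open set \<open>D1 \<inter> T\<close>, where the derivative is unique. Hence \<open>f'\<close>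
    agrees with \<open>f2\<close> on all of \<open>D2\<close>, as the induction hypothesis
    requires.\<close>
  have eq: "f1 x = f2 x" if "x \<in> D1" "x \<in> D2" for x
  proof -
    have *: "open (D1 \<inter> T)" "x \<in> D1 \<inter> T" using that T assms(1) by auto
    have "(f has_derivative f1 x) (at x within D1 \<inter> T)"
      by (rule has_derivative_subset[OF bspec[OF f1(1) that(1)]]) auto
    moreover have "(f has_derivative f2 x) (at x within D1 \<inter> T)"
      by (rule has_derivative_subset[OF bspec[OF f2(1) that(2)]]) (use T assms(2) in blast)
    ultimately show ?thesis unfolding at_within_open[OF *(2,1)] by (rule has_derivative_unique)
  qed
  define f' where "f' x = (if x \<in> D1 then f1 x else f2 x)" for x
  have "(f has_derivative f' x) (at x within D)" if "x \<in> D" for x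
  proof (cases "x \<in> D1")
    case True
    then have "(f has_derivative f1 x) (at x)" using f1 at_within_open[OF _ assms(1)] by auto
    then show ?thesis using True by (simp add: f'_def has_derivative_at_withinI)
  next
    case False
    then have x: "x \<in> D2" using that assms by auto
    then have "(f has_derivative f2 x) (at x within D2)" using f2 by auto
    moreover have "at x within D2 = at x within D"
      by (rule at_within_nhd[of x T]) (use T x in auto)
    ultimately show ?thesis using False by (simp add: f'_def)
  qed
  moreover have "Ck_on k D (\<lambda>x. f' x v)" for v
  proof (rule Suc.IH)
    show "Ck_on k D1 (\<lambda>x. f' x v)" using f1(2) by (rule_tac Ck_on_cong[of _ _ "\<lambda>x. f1 x v"]) (auto simp: f'_def)
    show "Ck_on k D2 (\<lambda>x. f' x v)" using f2(2) eq by (rule_tac Ck_on_cong[of _ _ "\<lambda>x. f2 x v"]) (auto simp: f'_def)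
  qed
  ultimately show ?case by (auto intro!: exI[of _ f'])
qed

text \<open>Each neighbourhood comes with its own witness for the derivative. On open sets these all
  coincide with \<open>frechet_derivative f (at x)\<close>, so this one choice can be used
  throughout the induction.\<close>

lemma Ck_on_open_local:
  fixes f :: "'a::euclidean_space \<Rightarrow> 'c::real_normed_vector"
  assumes "\<And>x. x \<in> D \<Longrightarrow> \<exists>N. open N \<and> x \<in> N \<and> N \<subseteq> D \<and> Ck_on k N f"
  shows "Ck_on k D f"
  using assms
proof (induction k arbitrary: f)
  case 0
  then show ?case
    by (simp, metis continuous_at_imp_continuous_on continuous_on_eq_continuous_at subsetD)
next
  case (Suc k)
  define f' where "f' x = frechet_derivative f (at x)" for x
  have key: "\<exists>N. open N \<and> x \<in> N \<and> N \<subseteq> D \<and> (\<forall>y\<in>N. (f has_derivative f' y) (at y)) \<and> (\<forall>v. Ck_on k N (\<lambda>x. f' x v))"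
    if x: "x \<in> D" for x
  proof -
    obtain N where N: "open N" "x \<in> N" "N \<subseteq> D" "Ck_on (Suc k) N f" using Suc.prems[OF x] by metis
    then obtain g where g: "\<forall>x\<in>N. (f has_derivative g x) (at x within N)" "\<forall>v. Ck_on k N (\<lambda>x. g x v)" by auto
    then have g': "(f has_derivative g y) (at y)" if "y \<in> N" for y using N that by (metis at_within_open)
    then have eq: "f' y = g y" if "y \<in> N" for y
      using that frechet_derivative_at unfolding f'_def by metis
    have "Ck_on k N (\<lambda>x. f' x v)" for v
      using g(2) eq by (rule_tac Ck_on_cong[of _ _ "\<lambda>x. g x v"]) auto
    then show ?thesis using N g' eq by (intro exI[of _ N]) auto
  qed
  have "\<forall>x\<in>D. (f has_derivative f' x) (at x within D)"
    using key has_derivative_at_withinI by blast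
  moreover have "Ck_on k D (\<lambda>x. f' x v)" for v
  proof (rule Suc.IH)
    fix x assume "x \<in> D"
    from key[OF this] obtain N where "open N" "x \<in> N" "N \<subseteq> D" "\<forall>v. Ck_on k N (\<lambda>x. f' x v)" by metis
    then show "\<exists>N. open N \<and> x \<in> N \<and> N \<subseteq> D \<and> Ck_on k N (\<lambda>x. f' x v)" by metis
  qed
  ultimately show ?case by (auto intro!: exI[of _ f'])
qed

text \<open>Inversion of linear maps is the second component of the inverse of \<open>(x, v) \<mapsto> (x, L x v)\<close>, so
  its regularity follows from invariance of domain and the inverse function theorem.\<close>

lemma
  fixes L :: "'a::euclidean_space \<Rightarrow> 'b::euclidean_space \<Rightarrow> 'b"
  assumes D: "open D" and lin: "\<And>x. x \<in> D \<Longrightarrow> linear (L x)" and bij: "\<And>x. x \<in> D \<Longrightarrow> bij (L x)"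
  shows continuous_on_inv_linear:
      "(\<And>v. continuous_on D (\<lambda>x. L x v)) \<Longrightarrow> continuous_on D (\<lambda>x. inv (L x) w)"
    and has_derivative_inv_linear:
      "(\<And>v y. y \<in> D \<Longrightarrow> ((\<lambda>x. L x v) has_derivative L' v y) (at y)) \<Longrightarrow> x \<in> D \<Longrightarrow>
       ((\<lambda>x. inv (L x) w) has_derivative
         (\<lambda>h. inv (L x) (- (\<Sum>b\<in>Basis. (inv (L x) w \<bullet> b) *\<^sub>R L' b x h)))) (at x)"
proof -
  define \<Psi> where "\<Psi> = (\<lambda>(x, v). (x, L x v))"
  define \<Phi> where "\<Phi> = (\<lambda>(x, v). (x, inv (L x) v))"
  have inv: "\<Phi> (\<Psi> p) = p" "\<Psi> (\<Phi> p) = p" if "p \<in> D \<times> UNIV" for p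
    using that bij by (auto simp: \<Psi>_def \<Phi>_def bij_is_inj bij_is_surj surj_f_inv_f)
  have im: "\<Psi> ` (D \<times> UNIV) = D \<times> UNIV"
  proof
    show "D \<times> UNIV \<subseteq> \<Psi> ` (D \<times> UNIV)"
    proof
      fix p :: "'a \<times> 'b" assume p: "p \<in> D \<times> UNIV"
      then have "\<Phi> p \<in> D \<times> UNIV" by (auto simp: \<Phi>_def)
      with inv(2)[OF p] show "p \<in> \<Psi> ` (D \<times> UNIV)" by (metis imageI)
    qed
  qed (auto simp: \<Psi>_def)
  have inj: "inj_on \<Psi> (D \<times> UNIV)" using inv by (metis inj_onI)
  have op: "open (D \<times> (UNIV :: 'b set))" using D by (simp add: open_Times)
  have \<Psi>_eq: "\<Psi> p = (fst p, \<Sum>b\<in>Basis. (snd p \<bullet> b) *\<^sub>R L (fst p) b)" if "p \<in> D \<times> UNIV" for p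
    using that linear_expand[OF lin, of "fst p" "snd p"] by (auto simp: \<Psi>_def)
  show "continuous_on D (\<lambda>x. inv (L x) w)" if cont: "\<And>v. continuous_on D (\<lambda>x. L x v)"
  proof -
    have c: "continuous_on (D \<times> (UNIV :: 'b set)) (\<lambda>p. L (fst p) b)" for b
      by (rule continuous_on_compose2[OF cont continuous_on_fst[OF continuous_on_id]]) auto
    have "continuous_on (D \<times> UNIV) (\<lambda>p. (fst p, \<Sum>b\<in>Basis. (snd p \<bullet> b) *\<^sub>R L (fst p) b))"
      by (intro continuous_intros c)
    then have "continuous_on (D \<times> UNIV) \<Psi>" by (rule continuous_on_eq) (simp add: \<Psi>_eq)
    then have "continuous_on (D \<times> UNIV) \<Phi>"
      using continuous_on_inverse_open[where f=\<Psi> and g=\<Phi>, OF op _ _ inv(1)] im by auto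
    then have "continuous_on D (\<lambda>x. snd (\<Phi> (x, w)))"
      by (intro continuous_on_snd continuous_on_compose2[of "D \<times> UNIV" \<Phi> D "\<lambda>x. (x, w)"]
          continuous_on_Pair continuous_on_id continuous_on_const) auto
    then show ?thesis by (simp add: \<Phi>_def)
  qed
  show "((\<lambda>x. inv (L x) w) has_derivative
         (\<lambda>h. inv (L x) (- (\<Sum>b\<in>Basis. (inv (L x) w \<bullet> b) *\<^sub>R L' b x h)))) (at x)"
    if der: "\<And>v y. y \<in> D \<Longrightarrow> ((\<lambda>x. L x v) has_derivative L' v y) (at y)" and x: "x \<in> D"
  proof -
    define \<Psi>' where "\<Psi>' = (\<lambda>p q. (fst q, \<Sum>b\<in>Basis. (snd p \<bullet> b) *\<^sub>R L' b (fst p) (fst q) + (snd q \<bullet> b) *\<^sub>R L (fst p) b))"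
    have der\<Psi>: "(\<Psi> has_derivative \<Psi>' p) (at p)" if p: "p \<in> D \<times> UNIV" for p
    proof -
      have 1: "((\<lambda>p. L (fst p) b) has_derivative (\<lambda>q. L' b (fst p) (fst q))) (at p)" for b
      proof (rule has_derivative_compose[of fst fst p UNIV "\<lambda>x. L x b" "L' b (fst p)"])
        show "(fst has_derivative fst) (at p)" by (simp add: bounded_linear_imp_has_derivative bounded_linear_fst)
      qed (use p in \<open>auto intro: der\<close>)
      have "((\<lambda>p. (fst p, \<Sum>b\<in>Basis. (snd p \<bullet> b) *\<^sub>R L (fst p) b)) has_derivative \<Psi>' p) (at p)"
        unfolding \<Psi>'_def
        by (intro has_derivative_Pair has_derivative_sum has_derivative_scaleR 1 has_derivative_inner_left
            bounded_linear_imp_has_derivative bounded_linear_fst bounded_linear_snd)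
      then show ?thesis
        by (rule has_derivative_transform_within_open[OF _ op p]) (simp add: \<Psi>_eq)
    qed
    define u where "u = inv (L x) w"
    \<comment> \<open>This inverts \<open>\<Psi>' (x, u)\<close>: the first component passes through
      unchanged, and the second equation is solved by applying \<open>inv (L x)\<close>.\<close>
    define \<Phi>' where "\<Phi>' = (\<lambda>q. (fst q, inv (L x) (snd q - (\<Sum>b\<in>Basis. (u \<bullet> b) *\<^sub>R L' b x (fst q)))))"
    have "\<Psi>' (x, u) \<circ> \<Phi>' = id"
    proof
      fix q
      have "(\<Sum>b\<in>Basis. (v \<bullet> b) *\<^sub>R L x b) = L x v" for v
        using linear_expand[OF lin[OF x], of v] by simp
      moreover have "L x (inv (L x) v) = v" for v using bij x by (simp add: bij_is_surj surj_f_inv_f)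
      ultimately show "(\<Psi>' (x, u) \<circ> \<Phi>') q = id q"
        by (simp add: \<Psi>'_def \<Phi>'_def sum.distrib prod_eq_iff)
    qed
    moreover have "continuous_on (D \<times> UNIV) \<Psi>"
      using der\<Psi> by (metis continuous_at_imp_continuous_on has_derivative_continuous)
    ultimately have "(\<Phi> has_derivative \<Phi>') (at (\<Psi> (x, u)))"
      using has_derivative_inverse_strong[OF op _ _ inv(1) der\<Psi>, of "(x, u)" "\<Phi>'"] x by auto
    moreover have "\<Psi> (x, u) = (x, w)" using inv(2)[of "(x, w)"] x by (simp add: u_def \<Phi>_def)
    ultimately have "(\<Phi> has_derivative \<Phi>') (at (x, w))" by simp
    \<comment> \<open>Along the slice of constant \<open>w\<close> the velocity is
      \<open>(h, 0)\<close>; the vanishing second entry leaves only the term with the minus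
      sign.\<close>
    then have "((\<lambda>x. snd (\<Phi> (x, w))) has_derivative (\<lambda>h. snd (\<Phi>' (h, 0)))) (at x)"
      by (intro has_derivative_snd has_derivative_compose[of "\<lambda>x. (x, w)" "\<lambda>h. (h, 0)" x UNIV \<Phi> \<Phi>'])
         (auto intro!: derivative_eq_intros)
    then show ?thesis by (simp add: \<Phi>_def \<Phi>'_def u_def)
  qed
qed

section \<open>The inverse function theorem in class \<open>C\<^sup>k\<close>\<close>

text \<open>The derivative of \<open>inv (L x)\<close> is the familiar expression "minus inverse,
  derivative of \<open>L\<close>, inverse". It involves nothing but the inverse itself and the
  derivative of \<open>L\<close>, so each order of regularity of the inverse yields the next
  one.\<close>

lemma Ck_on_inv_linear:
  fixes L :: "'a::euclidean_space \<Rightarrow> 'b::euclidean_space \<Rightarrow> 'b"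
  assumes D: "open D" and lin: "\<And>x. x \<in> D \<Longrightarrow> linear (L x)" and bij: "\<And>x. x \<in> D \<Longrightarrow> bij (L x)"
  shows "(\<And>v. Ck_on k D (\<lambda>x. L x v)) \<Longrightarrow> Ck_on k D (\<lambda>x. inv (L x) w)"
proof (induction k arbitrary: w)
  case 0
  then show ?case using continuous_on_inv_linear[OF D lin bij] by simp
next
  case (Suc k)
  then have "\<forall>v. \<exists>f'. (\<forall>x\<in>D. ((\<lambda>x. L x v) has_derivative f' x) (at x within D)) \<and> (\<forall>h. Ck_on k D (\<lambda>x. f' x h))"
    by simp
  then obtain L' where L': "\<And>v x. x \<in> D \<Longrightarrow> ((\<lambda>x. L x v) has_derivative L' v x) (at x within D)"
    "\<And>v h. Ck_on k D (\<lambda>x. L' v x h)" by metis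
  then have L'': "((\<lambda>x. L x v) has_derivative L' v y) (at y)" if "y \<in> D" for v y
    using that D by (metis at_within_open)
  have IH: "Ck_on k D (\<lambda>x. inv (L x) w)" for w using Suc Ck_on_Suc_imp by blast
  have lin_inv: "linear (inv (L x))" if "x \<in> D" for x
    using lin bij that by (metis bij_is_inj bij_is_surj inj_linear_imp_inv_linear)
  have "Ck_on k D (\<lambda>x. inv (L x) (- (\<Sum>b\<in>Basis. (inv (L x) w \<bullet> b) *\<^sub>R L' b x h)))" for h
  proof (rule Ck_on_apply_linear[OF lin_inv IH])
    have "Ck_on k D (\<lambda>x. inv (L x) w \<bullet> b)" for b
      by (rule Ck_on_bounded_linear_comp[OF bounded_linear_inner_left IH])
    then show "Ck_on k D (\<lambda>x. - (\<Sum>b\<in>Basis. (inv (L x) w \<bullet> b) *\<^sub>R L' b x h))"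
      by (rule_tac Ck_on_minus) (intro Ck_on_sum Ck_on_scaleR L' finite_Basis)
  qed
  moreover have "((\<lambda>x. inv (L x) w) has_derivative
         (\<lambda>h. inv (L x) (- (\<Sum>b\<in>Basis. (inv (L x) w \<bullet> b) *\<^sub>R L' b x h)))) (at x within D)" if "x \<in> D" for x
    by (rule has_derivative_at_withinI, rule has_derivative_inv_linear[OF D _ _ _ that]) (use lin bij L'' in auto)
  ultimately show ?case unfolding Ck_on.simps
    by (intro exI[of _ "\<lambda>x h. inv (L x) (- (\<Sum>b\<in>Basis. (inv (L x) w \<bullet> b) *\<^sub>R L' b x h))"]
        conjI ballI allI) blast
qed

text \<open>A bootstrap: the derivative of the inverse \<open>g\<close> at \<open>y\<close> is
  \<open>inv (F (g y))\<close>, so regularity of order \<open>k\<close> of \<open>g\<close>,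
  composed with inversion of linear maps, gives order \<open>k + 1\<close>. Continuity, the base
  case, is invariance of domain.\<close>

lemma Ck_on_inverse_function:
  fixes f :: "'a::euclidean_space \<Rightarrow> 'a"
  assumes D: "open D" and f: "\<And>k. Ck_on k D f" and inj: "inj_on f D"
    and der: "\<And>x f'. x \<in> D \<Longrightarrow> (f has_derivative f') (at x) \<Longrightarrow> inj f'"
  shows "Ck_on k (f ` D) (inv_into D f)"
proof -
  have cont: "continuous_on D f" using Ck_on_continuous[OF f] .
  show ?thesis
  proof (induction k)
    case 0
    show ?case using continuous_on_inverse_open[OF D cont _ inv_into_f_f[OF inj]] by simp
  next
    case (Suc k)
    obtain F where F: "\<And>x. x \<in> D \<Longrightarrow> (f has_derivative F x) (at x within D)" "\<And>v. Ck_on k D (\<lambda>x. F x v)"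
      using f[of "Suc k"] unfolding Ck_on.simps by blast
    then have F': "(f has_derivative F x) (at x)" if "x \<in> D" for x using that D by (metis at_within_open)
    have lin: "linear (F x)" if "x \<in> D" for x using F'[OF that] has_derivative_linear by blast
    have bij: "bij (F x)" if "x \<in> D" for x
      using der[OF that F'[OF that]] lin[OF that] by (simp add: bij_def linear_injective_imp_surjective)
    let ?g = "inv_into D f"
    have d: "(?g has_derivative inv (F (?g y))) (at y within f ` D)" if y: "y \<in> f ` D" for y
    proof -
      obtain x where x: "x \<in> D" "y = f x" using y by auto
      have "F x \<circ> inv (F x) = id" using bij[OF x(1)] by (simp add: bij_is_surj flip: surj_iff)
      then have "(?g has_derivative inv (F x)) (at (f x))"
        using has_derivative_inverse_strong[OF D x(1) cont inv_into_f_f[OF inj] F'[OF x(1)]] by simp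
      then show ?thesis using x inj by (simp add: has_derivative_at_withinI)
    qed
    have "Ck_on k (f ` D) (\<lambda>y. inv (F (?g y)) v)" for v
      by (rule Ck_on_compose[OF _ Suc.IH Ck_on_inv_linear[OF D lin bij F(2)]]) (auto intro: inv_into_into)
    then show ?case unfolding Ck_on.simps
      by (intro exI[of _ "\<lambda>y. inv (F (?g y))"] conjI ballI allI d)
  qed
qed

section \<open>Smooth maps on manifolds\<close>

lemma Cr_on_infinity: "Cr_on \<infinity> D f \<longleftrightarrow> (\<forall>k. Ck_on k D f)"
  by (simp add: Cr_on_def)

lemma coord_dom_eq: "coord_dom V g c d = snd c ` {x \<in> V \<inter> fst c. g x \<in> fst d}"
  by (simp add: coord_dom_def case_prod_beta)

lemma coord_map_eq: "coord_map g c d = snd d \<circ> g \<circ> inv_into (fst c) (snd c)"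
  by (simp add: coord_map_def case_prod_beta)

lemma smooth_transition_eq:
  "smooth_transition c d \<longleftrightarrow> Cr_on \<infinity> (snd c ` (fst c \<inter> fst d)) (snd d \<circ> inv_into (fst c) (snd c))"
  by (simp add: smooth_transition_def case_prod_beta)

text \<open>The positive-dimensional situation, with charts onto open subsets of the whole model
  space. The model \<open>{0}\<close> is treated separately when the first claim is
  assembled.\<close>

locale manifold_charts =
  fixes M :: "'a topology" and A :: "('a, 'b::euclidean_space) chart set"
  assumes is_chart: "c \<in> A \<Longrightarrow> is_chart M UNIV c"
    and charts_cover: "(\<Union>c\<in>A. fst c) = topspace M"
    and transition: "c \<in> A \<Longrightarrow> d \<in> A \<Longrightarrow> smooth_transition c d"
begin

lemma chart_homeo: "c \<in> A \<Longrightarrow> homeomorphic_map (subtopology M (fst c)) (top_of_set (snd c ` fst c)) (snd c)"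
  using is_chart[of c] by (simp add: is_chart_def case_prod_beta)

lemma chart_openin: "c \<in> A \<Longrightarrow> openin M (fst c)"
  using is_chart[of c] by (simp add: is_chart_def case_prod_beta)

lemma chart_subset: "c \<in> A \<Longrightarrow> fst c \<subseteq> topspace M"
  using chart_openin openin_subset by blast

lemma chart_open_range: "c \<in> A \<Longrightarrow> open (snd c ` fst c)"
  using is_chart[of c] by (simp add: is_chart_def case_prod_beta)

lemma chart_inj: "c \<in> A \<Longrightarrow> inj_on (snd c) (fst c)"
  using homeomorphic_imp_injective_map[OF chart_homeo] chart_subset by (simp add: Int_absorb1)

lemma chart_at: assumes "x \<in> topspace M" obtains c where "c \<in> A" "x \<in> fst c"
  using assms charts_cover by blast

lemma chart_inv: "c \<in> A \<Longrightarrow> x \<in> fst c \<Longrightarrow> inv_into (fst c) (snd c) (snd c x) = x"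
  using chart_inj inv_into_f_f by metis

lemma chart_open_image:
  assumes "c \<in> A" "openin M N" "N \<subseteq> fst c"
  shows "open (snd c ` N)"
proof -
  have "openin (top_of_set (snd c ` fst c)) (snd c ` N)"
    using homeomorphic_imp_open_map[OF chart_homeo[OF assms(1)]] assms
    by (simp add: open_map_def openin_open_subtopology chart_openin)
  then show ?thesis using chart_open_range[OF assms(1)] openin_open_trans by blast
qed

lemma chart_continuous: "c \<in> A \<Longrightarrow> continuous_map (subtopology M (fst c)) euclidean (snd c)"
  using homeomorphic_imp_continuous_map[OF chart_homeo] continuous_map_into_fulltopology by blast

lemma chart_inv_continuous:
  assumes "c \<in> A"
  shows "continuous_map (top_of_set (snd c ` fst c)) (subtopology M (fst c)) (inv_into (fst c) (snd c))"
proof -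
  obtain g where g: "homeomorphic_maps (subtopology M (fst c)) (top_of_set (snd c ` fst c)) (snd c) g"
    using chart_homeo[OF assms] homeomorphic_map_maps by blast
  have "g y = inv_into (fst c) (snd c) y" if "y \<in> snd c ` fst c" for y
  proof -
    obtain x where x: "x \<in> fst c" "y = snd c x" using \<open>y \<in> snd c ` fst c\<close> by auto
    then have "g y = x" using g chart_subset[OF assms] by (auto simp: homeomorphic_maps_def)
    then show ?thesis using x chart_inv[OF assms] by simp
  qed
  then show ?thesis
    using g continuous_map_eq[of "top_of_set (snd c ` fst c)" "subtopology M (fst c)" g] by (simp add: homeomorphic_maps_def)
qed

lemma Cr_map_subset:
  assumes "Cr_map M A r V g" "W \<subseteq> V" shows "Cr_map M A r W g"
proof -
  have "coord_dom W g c d \<subseteq> coord_dom V g c d" for c d :: "('a, 'b) chart"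
    using assms(2) by (auto simp: coord_dom_eq)
  then show ?thesis
    using assms unfolding Cr_map_def Cr_on_def
    by (meson Ck_on_mono continuous_map_from_subtopology_mono)
qed

lemma Cr_map_cong:
  assumes g: "Cr_map M A r V g" and eq: "\<And>x. x \<in> V \<Longrightarrow> g x = h x"
  shows "Cr_map M A r V h"
proof -
  have dom: "coord_dom V h c d = coord_dom V g c d" for c d :: "('a, 'b) chart"
    using eq by (auto simp: coord_dom_eq)
  have "Ck_on k (coord_dom V h c d) (coord_map h c d)"
    if "c \<in> A" "Ck_on k (coord_dom V g c d) (coord_map g c d)" for c d k
    using that(2) unfolding dom
    by (rule Ck_on_cong) (use eq chart_inv[OF that(1)] in \<open>auto simp: coord_dom_eq coord_map_eq\<close>)
  moreover have "continuous_map (subtopology M V) M h"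
    using g eq continuous_map_eq[of "subtopology M V" M g h] by (auto simp: Cr_map_def)
  ultimately show ?thesis using g unfolding Cr_map_def Cr_on_def by blast
qed

lemma Cr_map_id: "Cr_map M A \<infinity> V (\<lambda>x. x)"
proof -
  have "Ck_on k (coord_dom V (\<lambda>x. x) c d) (coord_map (\<lambda>x. x) c d)" if "c \<in> A" "d \<in> A" for c d k
  proof -
    have "Ck_on k (snd c ` (fst c \<inter> fst d)) (snd d \<circ> inv_into (fst c) (snd c))"
      using transition[OF that] by (simp add: smooth_transition_eq Cr_on_infinity)
    then have "Ck_on k (coord_dom V (\<lambda>x. x) c d) (snd d \<circ> inv_into (fst c) (snd c))"
      by (rule Ck_on_mono) (auto simp: coord_dom_eq)
    then show ?thesis by (rule Ck_on_cong) (auto simp: coord_map_eq)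
  qed
  then show ?thesis by (auto simp: Cr_map_def Cr_on_infinity continuous_map_from_subtopology)
qed

lemma openin_preimage:
  assumes "openin M N" "continuous_map (subtopology M N) X g" "openin X W"
  shows "openin M {x \<in> N. g x \<in> W}"
proof -
  have "topspace (subtopology M N) = N" using openin_subset[OF assms(1)] by auto
  then have "openin (subtopology M N) {x \<in> N. g x \<in> W}"
    using openin_continuous_map_preimage[OF assms(2,3)] by simp
  then show ?thesis using assms(1) openin_trans_full by blast
qed

lemma open_coord_dom:
  assumes "openin M N" "continuous_map (subtopology M N) M g" "c \<in> A" "d \<in> A"
  shows "open (coord_dom N g c d)"
proof -
  have "{x \<in> N \<inter> fst c. g x \<in> fst d} = fst c \<inter> {x \<in> N. g x \<in> fst d}" by auto
  then show ?thesis unfolding coord_dom_eq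
    by (intro chart_open_image assms) (use openin_preimage[OF assms(1,2) chart_openin[OF assms(4)]] chart_openin[OF assms(3)] in auto)
qed

text \<open>Coordinates of the composite have to pass through a chart around \<open>f x\<close>,
  which changes with \<open>x\<close>. The argument is therefore local, and
  \<open>Ck_on_open_local\<close> applies because the domain \<open>N\<close> is open.\<close>

lemma Cr_map_compose:
  assumes N: "openin M N" and f: "Cr_map M A \<infinity> N f" and fN: "f ` N \<subseteq> V" and g: "Cr_map M A \<infinity> V g"
  shows "Cr_map M A \<infinity> N (\<lambda>x. g (f x))"
proof -
  have contf: "continuous_map (subtopology M N) M f" and contg: "continuous_map (subtopology M V) M g"
    using f g by (auto simp: Cr_map_def)
  have cont: "continuous_map (subtopology M N) M (\<lambda>x. g (f x))"
    using continuous_map_compose[of "subtopology M N" "subtopology M V" f M g] contf contg fN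
    by (auto simp: continuous_map_in_subtopology o_def)
  have "Ck_on k (coord_dom N (\<lambda>x. g (f x)) c e) (coord_map (\<lambda>x. g (f x)) c e)" if c: "c \<in> A" and e: "e \<in> A" for c e k
  proof (rule Ck_on_open_local)
    fix p assume "p \<in> coord_dom N (\<lambda>x. g (f x)) c e"
    then obtain x where x: "x \<in> N" "x \<in> fst c" "g (f x) \<in> fst e" "p = snd c x" by (auto simp: coord_dom_eq)
    have "f x \<in> topspace M" using contf x N openin_subset[OF N] by (auto simp: continuous_map_def)
    then obtain d where d: "d \<in> A" "f x \<in> fst d" using chart_at by blast
    define O' where "O' = {x \<in> N. f x \<in> fst d} \<inter> fst c \<inter> {x \<in> N. g (f x) \<in> fst e}"
    have O': "openin M O'" unfolding O'_def
      by (intro openin_Int openin_preimage[OF N contf] openin_preimage[OF N cont] chart_openin c d e)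
    have "Ck_on k (snd c ` O') (coord_map (\<lambda>x. g (f x)) c e)"
    proof (rule Ck_on_cong)
      show "Ck_on k (snd c ` O') (\<lambda>p. coord_map g d e (coord_map f c d p))"
      proof (rule Ck_on_compose[where f="coord_map f c d" and g="coord_map g d e" and D'="coord_dom V g d e"])
        show "coord_map f c d ` snd c ` O' \<subseteq> coord_dom V g d e"
          using fN by (auto simp: coord_dom_eq coord_map_eq O'_def chart_inv[OF c])
        have "Ck_on k (coord_dom N f c d) (coord_map f c d)"
          using f c d by (auto simp: Cr_map_def Cr_on_infinity)
        then show "Ck_on k (snd c ` O') (coord_map f c d)"
          by (rule Ck_on_mono) (auto simp: coord_dom_eq O'_def)
        show "Ck_on k (coord_dom V g d e) (coord_map g d e)"
          using g d e by (auto simp: Cr_map_def Cr_on_infinity)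
      qed
    qed (auto simp: coord_map_eq O'_def chart_inv c d)
    then show "\<exists>N'. open N' \<and> p \<in> N' \<and> N' \<subseteq> coord_dom N (\<lambda>x. g (f x)) c e \<and>
        Ck_on k N' (coord_map (\<lambda>x. g (f x)) c e)"
      using x d O' c chart_open_image[OF c O']
      by (intro exI[of _ "snd c ` O'"]) (auto simp: O'_def coord_dom_eq)
  qed
  with cont show ?thesis by (auto simp: Cr_map_def Cr_on_infinity)
qed

lemma transition_differentiable:
  assumes "c \<in> A" "d \<in> A" "x \<in> fst c" "x \<in> fst d"
  obtains B where "((snd d \<circ> inv_into (fst c) (snd c)) has_derivative B) (at (snd c x))"
proof -
  let ?D = "snd c ` (fst c \<inter> fst d)"
  have "open ?D" using assms by (intro chart_open_image) (auto intro: chart_openin)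
  moreover have "Ck_on (Suc 0) ?D (snd d \<circ> inv_into (fst c) (snd c))"
    using transition[OF assms(1,2)] unfolding smooth_transition_eq Cr_on_infinity by blast
  moreover have "snd c x \<in> ?D" using assms by auto
  ultimately obtain B where "((snd d \<circ> inv_into (fst c) (snd c)) has_derivative B) (at (snd c x) within ?D)"
    unfolding Ck_on.simps by blast
  then show ?thesis using that at_within_open[OF \<open>snd c x \<in> ?D\<close> \<open>open ?D\<close>] by simp
qed

text \<open>By the chain rule, injectivity of the tangent map may be tested in any pair of charts.\<close>

lemma tangent_map_inj:
  assumes N: "openin M N" and cont: "continuous_map (subtopology M N) M g" and z: "z \<in> N"
    and T: "tangent_map A N g z D" and inj: "inj D"
    and c: "c \<in> A" "z \<in> fst c" and d: "d \<in> A" "g z \<in> fst d"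
    and D': "(coord_map g c d has_derivative D') (at (snd c z))"
  shows "inj D'"
proof -
  obtain c0 d0 where c0: "c0 \<in> A" "z \<in> fst c0" and d0: "d0 \<in> A" "g z \<in> fst d0"
    and D: "(coord_map g c0 d0 has_derivative D) (at (snd c0 z) within coord_dom N g c0 d0)"
    using T by (auto simp: tangent_map_def)
  have "snd c0 z \<in> coord_dom N g c0 d0" using z c0 d0 by (auto simp: coord_dom_eq)
  then have D: "(coord_map g c0 d0 has_derivative D) (at (snd c0 z))"
    using D open_coord_dom[OF N cont c0(1) d0(1)] by (metis at_within_open)
  obtain B where B: "((snd c \<circ> inv_into (fst c0) (snd c0)) has_derivative B) (at (snd c0 z))"
    using transition_differentiable c c0 by metis
  obtain C where C: "((snd d0 \<circ> inv_into (fst d) (snd d)) has_derivative C) (at (snd d (g z)))"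
    using transition_differentiable d d0 by metis
  let ?F = "\<lambda>p. (snd d0 \<circ> inv_into (fst d) (snd d)) (coord_map g c d ((snd c \<circ> inv_into (fst c0) (snd c0)) p))"
  have "((\<lambda>p. coord_map g c d ((snd c \<circ> inv_into (fst c0) (snd c0)) p)) has_derivative (\<lambda>v. D' (B v))) (at (snd c0 z))"
    by (rule has_derivative_compose[OF B]) (simp add: chart_inv c0 D')
  then have "(?F has_derivative (\<lambda>v. C (D' (B v)))) (at (snd c0 z))"
    by (rule has_derivative_compose) (use C in \<open>simp add: chart_inv c0 c coord_map_eq o_def\<close>)
  moreover define O' where "O' = fst c0 \<inter> fst c \<inter> {x \<in> N. g x \<in> fst d} \<inter> {x \<in> N. g x \<in> fst d0}"
  have O': "openin M O'" unfolding O'_def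
    by (intro openin_Int openin_preimage[OF N cont] chart_openin c c0 d d0)
  have "open (snd c0 ` O')" using chart_open_image[OF c0(1) O'] by (auto simp: O'_def)
  ultimately have "(coord_map g c0 d0 has_derivative (\<lambda>v. C (D' (B v)))) (at (snd c0 z))"
    by (rule_tac has_derivative_transform_within_open[of ?F _ _ _ "snd c0 ` O'"])
       (use z c c0 d d0 in \<open>auto simp: O'_def coord_map_eq chart_inv\<close>)
  then have eq: "D = (\<lambda>v. C (D' (B v)))" using D has_derivative_unique by blast
  have linB: "linear B" using B has_derivative_linear by blast
  \<comment> \<open>Injectivity of the composite \<open>D\<close> forces that of its first factor
    \<open>B\<close>, and equality of dimensions makes \<open>B\<close> onto. Every pair of vectors
    thus comes from a pair on which \<open>D\<close> is injective.\<close>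
  have "inj B" using inj unfolding eq inj_def by metis
  then have "surj B" using linB linear_injective_imp_surjective by blast
  show "inj D'"
  proof (rule injI)
    fix u v assume "D' u = D' v"
    moreover obtain u' v' where "u = B u'" "v = B v'" using \<open>surj B\<close> by (metis surjD)
    ultimately have "D u' = D v'" by (simp add: eq)
    then show "u = v" using inj \<open>u = B u'\<close> \<open>v = B v'\<close> by (auto dest: injD)
  qed
qed

text \<open>Openness of \<open>g\<close> makes the inverse continuous, and the inverse function
  theorem in coordinates then makes it smooth. The tangent maps are supplied in some unspecified
  charts, hence the appeal to \<open>tangent_map_inj\<close>.\<close>

lemma Cr_map_inverse:
  assumes N: "openin M N" and g: "Cr_map M A \<infinity> N g" and inj: "inj_on g N"
    and op: "\<And>W. openin M W \<Longrightarrow> W \<subseteq> N \<Longrightarrow> openin M (g ` W)"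
    and tan: "\<And>z. z \<in> N \<Longrightarrow> \<exists>D. tangent_map A N g z D \<and> inj D"
  shows "Cr_map M A \<infinity> (g ` N) (inv_into N g)"
proof -
  have cont: "continuous_map (subtopology M N) M g" using g by (simp add: Cr_map_def)
  have gN: "openin M (g ` N)" using op N by blast
  have "continuous_map (subtopology M (g ` N)) M (inv_into N g)"
    unfolding continuous_map_def
  proof (intro conjI allI impI)
    show "inv_into N g \<in> topspace (subtopology M (g ` N)) \<rightarrow> topspace M"
      using openin_subset[OF N] inv_into_into[of _ g N] by (auto intro!: subsetD[OF openin_subset[OF N]])
    fix W assume W: "openin M W"
    have "{x \<in> topspace (subtopology M (g ` N)). inv_into N g x \<in> W} = g ` (N \<inter> W)"
      using openin_subset[OF gN] inj by auto
    then show "openin (subtopology M (g ` N)) {x \<in> topspace (subtopology M (g ` N)). inv_into N g x \<in> W}"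
      using op[of "N \<inter> W"] N W by (auto simp: openin_open_subtopology[OF gN])
  qed
  moreover have "Ck_on k (coord_dom (g ` N) (inv_into N g) c d) (coord_map (inv_into N g) c d)"
    if c: "c \<in> A" and d: "d \<in> A" for c d k
  proof -
    let ?D = "coord_dom N g d c" and ?G = "coord_map g d c"
    have im: "?G ` ?D = coord_dom (g ` N) (inv_into N g) c d"
      using inj chart_inv[OF d] by (force simp: coord_dom_eq coord_map_eq)
    have injG: "inj_on ?G ?D"
      by (auto simp: coord_dom_eq coord_map_eq chart_inv[OF d] intro!: inj_onI
          dest!: inj_onD[OF chart_inj[OF c]] inj_onD[OF inj])
    have "Ck_on k (?G ` ?D) (inv_into ?D ?G)"
    proof (rule Ck_on_inverse_function[OF _ _ injG])
      show "open ?D" using open_coord_dom[OF N cont d c] .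
      show "Ck_on k ?D ?G" for k using g c d by (auto simp: Cr_map_def Cr_on_infinity)
      fix p f' assume "p \<in> ?D" "(?G has_derivative f') (at p)"
      moreover then obtain z where "z \<in> N" "z \<in> fst d" "g z \<in> fst c" "p = snd d z" by (auto simp: coord_dom_eq)
      ultimately show "inj f'" using tangent_map_inj[OF N cont _ _ _ d _ c] tan by blast
    qed
    then show ?thesis unfolding im[symmetric]
    proof (rule Ck_on_cong)
      fix q assume "q \<in> ?G ` ?D"
      then obtain z where z: "z \<in> N" "z \<in> fst d" "g z \<in> fst c" "q = ?G (snd d z)" by (auto simp: coord_dom_eq)
      then have "snd d z \<in> ?D" by (auto simp: coord_dom_eq)
      then have "inv_into ?D ?G q = snd d z" unfolding z(4) by (rule inv_into_f_f[OF injG])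
      moreover have "coord_map (inv_into N g) c d q = snd d z"
        using z by (simp add: coord_map_eq chart_inv c d inj)
      ultimately show "inv_into ?D ?G q = coord_map (inv_into N g) c d q" by simp
    qed
  qed
  ultimately show ?thesis by (auto simp: Cr_map_def Cr_on_infinity)
qed

text \<open>Invariance of domain with a parameter: extending the isotopy constantly beyond time 1 turns
  it into an injective map between open subsets of the product of the model space with the line.\<close>

lemma openin_isotopy_image:
  fixes \<rho> :: "real \<Rightarrow> 'a \<Rightarrow> 'a"
  assumes N: "openin M N"
    and cont: "continuous_map (prod_topology (subtopology M N) (top_of_set {0<..1})) M (\<lambda>(x, t). \<rho> t x)"
    and inj: "\<And>t. t \<in> {0<..1} \<Longrightarrow> inj_on (\<rho> t) N"
  shows "openin (prod_topology M (top_of_set {0..1})) {(x, t). t \<in> {0<..1} \<and> x \<in> \<rho> t ` N}"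
proof (subst openin_subopen, safe)
  fix t0 :: real and y0 assume t0: "t0 \<in> {0<..1}" and y0: "y0 \<in> N"
  have contt: "continuous_map (subtopology M N) M (\<rho> t)" if "t \<in> {0<..1}" for t
    using continuous_map_compose[OF _ cont, of "subtopology M N" "\<lambda>x. (x, t)"] that
    by (auto simp: o_def continuous_map_pairedI)
  have y0M: "y0 \<in> topspace M" and r0: "\<rho> t0 y0 \<in> topspace M"
    using contt[OF t0] y0 openin_subset[OF N] by (auto simp: continuous_map_def)
  obtain c where c: "c \<in> A" "y0 \<in> fst c" using y0M chart_at by blast
  obtain d where d: "d \<in> A" "\<rho> t0 y0 \<in> fst d" using r0 chart_at by blast
  define S where "S = snd c ` (N \<inter> fst c) \<times> {0::real<..}"
  define G where "G q = \<rho> (min (snd q) 1) (inv_into (fst c) (snd c) (fst q))" for q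
  have Ncd: "openin M (N \<inter> fst c)" using N chart_openin c by blast
  have openS: "open S" unfolding S_def
    by (intro open_Times chart_open_image[OF c(1) Ncd]) auto
  have contG: "continuous_map (top_of_set S) M G"
  proof -
    have 1: "continuous_map (top_of_set S) (top_of_set (snd c ` fst c)) fst"
      by (auto simp: continuous_map_in_subtopology S_def intro!: continuous_on_fst continuous_on_id)
    have "continuous_map (top_of_set S) (subtopology M N) (\<lambda>q. inv_into (fst c) (snd c) (fst q))"
      using continuous_map_compose[OF 1 chart_inv_continuous[OF c(1)]]
      by (auto simp: continuous_map_in_subtopology o_def S_def chart_inv c(1))
    moreover have "continuous_map (top_of_set S) (top_of_set {0<..1}) (\<lambda>q. min (snd q) 1)"
      by (auto simp: continuous_map_in_subtopology S_def intro!: continuous_on_snd continuous_on_id continuous_intros)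
    ultimately have "continuous_map (top_of_set S) (prod_topology (subtopology M N) (top_of_set {0<..1}))
        (\<lambda>q. (inv_into (fst c) (snd c) (fst q), min (snd q) 1))"
      by (rule continuous_map_pairedI)
    from continuous_map_compose[OF this cont] show ?thesis
      by (simp add: o_def G_def[abs_def])
  qed
  define Q where "Q = {q \<in> S. G q \<in> fst d}"
  have "openin (top_of_set S) Q"
    using openin_continuous_map_preimage[OF contG chart_openin[OF d(1)]] by (simp add: Q_def)
  then have openQ: "open Q" using openS openin_open_trans by blast
  define \<Psi> where "\<Psi> q = (snd d (G q), snd q)" for q
  have "continuous_map (top_of_set Q) (subtopology M (fst d)) G"
    using continuous_map_from_subtopology_mono[OF contG, of Q]
    by (auto simp: continuous_map_in_subtopology Q_def)
  from continuous_map_compose[OF this chart_continuous[OF d(1)]]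
  have "continuous_on Q \<Psi>"
    by (auto simp: o_def \<Psi>_def intro!: continuous_on_Pair continuous_on_snd continuous_on_id)
  moreover have "inj_on \<Psi> Q"
  proof (rule inj_onI)
    fix q q' assume q: "q \<in> Q" "q' \<in> Q" and eq: "\<Psi> q = \<Psi> q'"
    then have "G q = G q'" "snd q = snd q'"
      using chart_inj[OF d(1)] by (auto simp: \<Psi>_def Q_def dest: inj_onD)
    moreover have "min (snd q) 1 \<in> {0<..1}" using q by (auto simp: Q_def S_def)
    moreover have "inv_into (fst c) (snd c) (fst q) \<in> N" "inv_into (fst c) (snd c) (fst q') \<in> N"
      using q by (auto simp: Q_def S_def chart_inv c(1))
    ultimately have "inv_into (fst c) (snd c) (fst q) = inv_into (fst c) (snd c) (fst q')"
      using inj[of "min (snd q) 1"] by (auto simp: G_def dest: inj_onD)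
    then have "fst q = fst q'"
      using q by (auto simp: Q_def S_def chart_inv c(1))
    with \<open>snd q = snd q'\<close> show "q = q'" by (simp add: prod_eq_iff)
  qed
  ultimately have open\<Psi>: "open (\<Psi> ` Q)" using invariance_of_domain openQ by blast
  let ?X = "prod_topology M (top_of_set {0..1::real})"
  let ?Y = "prod_topology (subtopology M (fst d)) (top_of_set {0..1::real})"
  define T where "T = {p \<in> fst d \<times> {0..1}. (snd d (fst p), snd p) \<in> \<Psi> ` Q}"
  have "continuous_map ?Y (prod_topology euclidean euclidean) (\<lambda>p. (snd d (fst p), snd p))"
    using continuous_map_compose[OF continuous_map_fst chart_continuous[OF d(1)], of "top_of_set {0..1::real}"]
      continuous_map_into_fulltopology[OF continuous_map_snd, of "subtopology M (fst d)" euclidean "{0..1::real}"]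
    by (intro continuous_map_pairedI) (auto simp: o_def)
  then have "openin ?Y T"
    using openin_continuous_map_preimage[of ?Y euclidean "\<lambda>p. (snd d (fst p), snd p)" "\<Psi> ` Q"] open\<Psi> chart_subset[OF d(1)]
    by (auto simp: T_def Int_absorb1)
  moreover have "?Y = subtopology ?X (fst d \<times> {0..1})"
    by (metis prod_topology_subtopology(1) topspace_euclidean_subtopology)
  moreover have "openin ?X (fst d \<times> {0..1})"
    using chart_openin[OF d(1)] by (simp add: openin_prod_Times_iff)
  ultimately have "openin ?X T"
    using openin_trans_full by metis
  moreover have "(\<rho> t0 y0, t0) \<in> T"
  proof -
    have "(snd c y0, t0) \<in> Q" using y0 t0 c d by (auto simp: Q_def S_def G_def chart_inv)
    moreover have "\<Psi> (snd c y0, t0) = (snd d (\<rho> t0 y0), t0)"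
      using t0 c by (simp add: \<Psi>_def G_def chart_inv)
    ultimately show ?thesis using d t0 by (force simp: T_def)
  qed
  moreover have "T \<subseteq> {(x, t). t \<in> {0<..1} \<and> x \<in> \<rho> t ` N}"
  proof
    fix p assume p: "p \<in> T"
    then obtain q where q: "q \<in> Q" "\<Psi> q = (snd d (fst p), snd p)" by (auto simp: T_def)
    then have "G q = fst p" "snd q = snd p"
      using chart_inj[OF d(1)] p by (auto simp: \<Psi>_def Q_def T_def dest: inj_onD)
    moreover have "snd p \<in> {0<..1}" using p q \<open>snd q = snd p\<close> by (auto simp: T_def Q_def S_def)
    moreover have "inv_into (fst c) (snd c) (fst q) \<in> N" using q by (auto simp: Q_def S_def chart_inv c(1))
    ultimately show "p \<in> {(x, t). t \<in> {0<..1} \<and> x \<in> \<rho> t ` N}"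
      by (auto simp: G_def case_prod_beta intro: rev_image_eqI)
  qed
  ultimately show "\<exists>T. openin ?X T \<and> (\<rho> t0 y0, t0) \<in> T \<and> T \<subseteq> {(x, t). t \<in> {0<..1} \<and> x \<in> \<rho> t ` N}"
    by blast
qed

end

section \<open>Maps that are locally the identity\<close>

context manifold_charts begin

text \<open>Both branches of the definition occur. At a point outside the interior the same chart is
  used at source and target, and the coordinate representative coincides with the identity near the
  point, within its domain.\<close>

lemma local_diffeo_at_identity:
  assumes O': "openin M O'" and z: "z \<in> V" "z \<in> O'" and id: "\<And>x. x \<in> V \<inter> O' \<Longrightarrow> g x = x"
  shows "local_diffeo_at M A V g z"
proof (cases "z \<in> M interior_of V")
  case True
  define W where "W = M interior_of V \<inter> O'"
  have W: "openin M W" "z \<in> W" using O' True z by (auto simp: W_def)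
  have WV: "W \<subseteq> V" using interior_of_subset by (force simp: W_def)
  have id: "g x = x" if "x \<in> W" for x using id[of x] that WV by (auto simp: W_def)
  have img: "g ` W = W" using id by auto
  have inj: "inj_on g W" using id by (auto intro!: inj_onI)
  have "Cr_map M A \<infinity> W g" by (rule Cr_map_cong[OF Cr_map_id]) (simp add: id)
  moreover have "Cr_map M A \<infinity> W (inv_into W g)"
  proof (rule Cr_map_cong[OF Cr_map_id])
    fix x assume "x \<in> W"
    then show "x = inv_into W g x" using inv_into_f_f[OF inj, of x] id by simp
  qed
  ultimately show ?thesis
    using W WV img inj True by (auto simp: local_diffeo_at_def intro!: exI[of _ W])
next
  case False
  obtain c where c: "c \<in> A" "z \<in> fst c" using chart_at[of z] z O' openin_subset by blast
  let ?S = "snd c ` (fst c \<inter> O')"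
  have "open ?S" using chart_open_image[OF c(1)] chart_openin[OF c(1)] O' by blast
  then obtain e where e: "e > 0" "ball (snd c z) e \<subseteq> ?S" using z c openE by (metis (no_types, lifting) IntI imageI)
  have "(coord_map g c c has_derivative id) (at (snd c z) within coord_dom V g c c)"
  proof (rule has_derivative_transform_within[OF has_derivative_id e(1)])
    show "snd c z \<in> coord_dom V g c c" using c z id by (auto simp: coord_dom_eq)
    fix q assume q: "q \<in> coord_dom V g c c" "dist q (snd c z) < e"
    then obtain x where x: "x \<in> V" "x \<in> fst c" "q = snd c x" by (auto simp: coord_dom_eq)
    have "q \<in> ?S" using q e by (auto simp: dist_commute subset_iff)
    then have "x \<in> O'" using x chart_inj[OF c(1)] by (auto dest: inj_onD)
    then show "id q = coord_map g c c q" using x id by (simp add: coord_map_eq chart_inv c)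
  qed
  moreover have "g z = z" using id z by blast
  ultimately have "tangent_map A V g z id" using c by (auto simp: tangent_map_def)
  then show ?thesis using False by (auto simp: local_diffeo_at_def)
qed

lemma identity_in_\<E>: "V \<subseteq> topspace M \<Longrightarrow> (\<lambda>x\<in>V. x) \<in> \<E> M A \<P> \<Sigma> V"
  using Cr_map_cong[OF Cr_map_id, of V "\<lambda>x\<in>V. x"] local_diffeo_at_identity[of "topspace M" _ V "\<lambda>x\<in>V. x"]
  by (auto simp: \<E>_def Cr_maps_def)

end

section \<open>The isotopy of an invariant contraction\<close>

locale contraction_isotopy = manifold_charts M A for M :: "'a topology" and A :: "('a, 'b::euclidean_space) chart set" +
  fixes \<P> \<Sigma> Z V and \<rho> :: "real \<Rightarrow> 'a \<Rightarrow> 'a" and U h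
  assumes Hausdorff: "Hausdorff_space M"
    and partition: "singular_partition M \<P> \<Sigma>"
    and V_closed: "closedin M V" and V_invariant: "invariant_set M \<P> V"
    and \<rho>_continuous: "continuous_map (prod_topology (subtopology M V) (top_of_set {0..1})) (subtopology M V)
          (\<lambda>(x, t). \<rho> t x)"
    and \<rho>_1: "\<And>x. x \<in> V \<Longrightarrow> \<rho> 1 x = x"
    and \<rho>_0: "\<rho> 0 ` V = Z" "\<And>z. z \<in> Z \<Longrightarrow> \<rho> 0 z = z"
    and \<rho>_proper: "\<And>K. K \<subseteq> Z \<Longrightarrow> compactin M K \<Longrightarrow> compactin M {x\<in>V. \<rho> 0 x \<in> K}"
    and \<rho>_embedding: "\<And>t. t \<in> {0<..1} \<Longrightarrow> closed_Cr_embedding M A \<infinity> V (\<rho> t)"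
    and \<rho>_regular: "\<And>t \<omega>. t \<in> {0<..1} \<Longrightarrow> \<omega> \<in> \<P> - \<Sigma> \<Longrightarrow> \<omega> \<subseteq> V \<Longrightarrow> \<rho> t ` \<omega> \<in> \<P> - \<Sigma>"
    and \<rho>_singular: "\<And>t \<omega>. t \<in> {0<..1} \<Longrightarrow> \<omega> \<in> \<Sigma> \<Longrightarrow> \<omega> \<subseteq> V \<Longrightarrow> \<rho> t ` \<omega> \<in> \<Sigma>"
    and fibre_invariant: "\<And>z. z \<in> Z \<Longrightarrow> invariant_set M \<P> {x\<in>V. \<rho> 0 x = z}"
    and \<rho>_fibre: "\<And>z t. z \<in> Z \<Longrightarrow> t \<in> {0..1} \<Longrightarrow> \<rho> t ` {x\<in>V. \<rho> 0 x = z} \<subseteq> {x\<in>V. \<rho> 0 x = z}"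
    and h: "h \<in> \<E> M A \<P> \<Sigma> V"
    and U: "U \<subseteq> topspace M" "M closure_of U \<subseteq> M interior_of V" "\<And>x. x \<in> V - U \<Longrightarrow> h x = x"
begin

abbreviation N where "N \<equiv> M interior_of V"

text \<open>The Alexander trick: \<open>h\<close> is conjugated by the embedding \<open>\<rho> t\<close>, which shrinks its support
  to \<open>Z\<close> as \<open>t\<close> tends to 0.\<close>

definition H :: "real \<Rightarrow> 'a \<Rightarrow> 'a" where
  "H t = (\<lambda>x\<in>V. if 0 < t \<and> x \<in> \<rho> t ` N then \<rho> t (h (inv_into N (\<rho> t) x)) else x)"

lemma N_open: "openin M N" by simp
lemma N_subset: "N \<subseteq> V" by (rule interior_of_subset)
lemma V_subset: "V \<subseteq> topspace M" using V_closed closedin_subset by blast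
lemma U_subset_N: "U \<subseteq> N" using U closure_of_subset by blast

lemma topspace_V: "topspace (subtopology M V) = V" using V_subset by auto

lemma \<rho>_in: "t \<in> {0..1} \<Longrightarrow> x \<in> V \<Longrightarrow> \<rho> t x \<in> V"
  using continuous_map_image_subset_topspace[OF \<rho>_continuous] V_subset by (force simp: image_subset_iff)

lemma \<rho>_inj: "t \<in> {0<..1} \<Longrightarrow> inj_on (\<rho> t) V"
  using homeomorphic_imp_injective_map[of "subtopology M V" _ "\<rho> t"] \<rho>_embedding[of t]
  unfolding closed_Cr_embedding_def embedding_map_def topspace_V by blast

lemma \<rho>_smooth: "t \<in> {0<..1} \<Longrightarrow> Cr_map M A \<infinity> V (\<rho> t)"
  using \<rho>_embedding[of t] by (simp add: closed_Cr_embedding_def)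

lemma element_at: assumes "x \<in> V" obtains \<omega> where "\<omega> \<in> \<P>" "x \<in> \<omega>" "\<omega> \<subseteq> V"
proof -
  have "x \<in> \<Union>\<P>" using assms V_subset partition unfolding singular_partition_def partition_on_def by auto
  then show ?thesis using that assms V_invariant unfolding invariant_set_def by blast
qed

lemma elements_eq: "\<omega> \<in> \<P> \<Longrightarrow> \<omega>' \<in> \<P> \<Longrightarrow> x \<in> \<omega> \<Longrightarrow> x \<in> \<omega>' \<Longrightarrow> \<omega> = \<omega>'"
  using partition unfolding singular_partition_def partition_on_def by (meson disjointD disjoint_iff)

lemma \<Sigma>_subset: "\<Sigma> \<subseteq> \<P>"
  using partition by (simp add: singular_partition_def)

lemma h_element: "x \<in> \<omega> \<Longrightarrow> \<omega> \<in> \<P> \<Longrightarrow> x \<in> V \<Longrightarrow> h x \<in> \<omega>"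
  using h by (auto simp: \<E>_def)

lemma h_in: "x \<in> V \<Longrightarrow> h x \<in> V"
  using element_at h_element by (metis subsetD)

lemma h_smooth: "Cr_map M A \<infinity> V h"
  using h by (auto simp: \<E>_def Cr_maps_def)

lemma \<rho>_element: "t \<in> {0<..1} \<Longrightarrow> \<omega> \<in> \<P> \<Longrightarrow> \<omega> \<subseteq> V \<Longrightarrow> \<rho> t ` \<omega> \<in> \<P>"
  using \<rho>_regular \<rho>_singular \<Sigma>_subset by blast

text \<open>Fibres of \<open>\<rho> 0\<close> are invariant, so each element meeting a fibre is
  contained in it, and \<open>h\<close> does not leave elements. This is what forces
  \<open>H t\<close> towards the identity as \<open>t\<close> tends to 0.\<close>

lemma \<rho>_0_h: assumes "x \<in> V" shows "\<rho> 0 (h x) = \<rho> 0 x"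
proof -
  obtain \<omega> where \<omega>: "\<omega> \<in> \<P>" "x \<in> \<omega>" "\<omega> \<subseteq> V" using element_at assms by blast
  have "\<rho> 0 x \<in> Z" using \<rho>_0 assms by blast
  then have "\<omega> \<subseteq> {y \<in> V. \<rho> 0 y = \<rho> 0 x}" using fibre_invariant \<omega> unfolding invariant_set_def by blast
  then show ?thesis using h_element \<omega> assms by blast
qed

lemma \<rho>_0_\<rho>: "x \<in> V \<Longrightarrow> t \<in> {0..1} \<Longrightarrow> \<rho> 0 (\<rho> t x) = \<rho> 0 x"
  using \<rho>_fibre[of "\<rho> 0 x" t] \<rho>_0 by blast

lemma H_conj:
  assumes t: "t \<in> {0<..1}" and y: "y \<in> V" shows "H t (\<rho> t y) = \<rho> t (h y)"
proof -
  have V: "\<rho> t y \<in> V" using \<rho>_in t y by auto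
  have inj: "inj_on (\<rho> t) N" using \<rho>_inj[OF t] N_subset inj_on_subset by blast
  show ?thesis
  proof (cases "y \<in> N")
    case True
    then show ?thesis using V t inj by (simp add: H_def)
  next
    case False
    then have "h y = y" using U_subset_N U(3) y by blast
    moreover have "\<rho> t y \<notin> \<rho> t ` N" using False \<rho>_inj[OF t] y N_subset by (metis inj_on_image_mem_iff)
    ultimately show ?thesis using V by (simp add: H_def)
  qed
qed

lemma H_outside: "x \<in> V \<Longrightarrow> x \<notin> \<rho> t ` (M closure_of U) \<Longrightarrow> t \<in> {0..1} \<Longrightarrow> H t x = x"
proof -
  assume x: "x \<in> V" "x \<notin> \<rho> t ` (M closure_of U)" and t: "t \<in> {0..1}"
  show "H t x = x"
  proof (cases "0 < t \<and> x \<in> \<rho> t ` N")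
    case True
    then obtain y where y: "y \<in> N" "x = \<rho> t y" by blast
    then have "y \<notin> U" using x U closure_of_subset by blast
    then have "h y = y" using y N_subset U(3) by blast
    moreover have "H t x = \<rho> t (h y)" using H_conj[of t y] t True y N_subset by auto
    ultimately show ?thesis using y by simp
  qed (use x in \<open>auto simp: H_def\<close>)
qed

lemma H_0: "H 0 = (\<lambda>x\<in>V. x)" by (simp add: H_def)

lemma H_1: "H 1 = h"
proof
  fix x
  show "H 1 x = h x"
  proof (cases "x \<in> V")
    case True
    then show ?thesis using H_conj[of 1 x] \<rho>_1 h_in by simp
  next
    case False
    moreover have "h \<in> extensional V" using h by (auto simp: \<E>_def Cr_maps_def PiE_def)
    ultimately show ?thesis by (simp add: H_def extensional_def)
  qed
qed

text \<open>Images of elements under \<open>\<rho> t\<close> are again elements, and elements are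
  disjoint. So the element through \<open>\<rho> t y\<close> is the image of the one through
  \<open>y\<close>, which \<open>h\<close> preserves.\<close>

lemma H_element:
  assumes t: "t \<in> {0..1}" and \<omega>: "\<omega> \<in> \<P>" "x \<in> \<omega>" and x: "x \<in> V"
  shows "H t x \<in> \<omega>"
proof (cases "0 < t \<and> x \<in> \<rho> t ` N")
  case True
  then obtain y where y: "y \<in> N" "x = \<rho> t y" by blast
  then obtain \<omega>' where \<omega>': "\<omega>' \<in> \<P>" "y \<in> \<omega>'" "\<omega>' \<subseteq> V" using element_at N_subset by blast
  then have "\<rho> t ` \<omega>' = \<omega>" using \<rho>_element[of t \<omega>'] t True elements_eq[of "\<rho> t ` \<omega>'" \<omega> x] \<omega> y by auto
  moreover have "H t x = \<rho> t (h y)" using H_conj[of t y] t True y N_subset by auto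
  moreover have "h y \<in> \<omega>'" using h_element \<omega>' by blast
  ultimately show ?thesis by blast
qed (use \<omega> x in \<open>auto simp: H_def\<close>)

lemma H_in: "t \<in> {0..1} \<Longrightarrow> x \<in> V \<Longrightarrow> H t x \<in> V"
  using element_at H_element by (metis subsetD)

text \<open>Openness jointly in \<open>x\<close> and \<open>t\<close> serves twice: at a fixed time
  it shows that \<open>\<rho> t\<close> is open on \<open>N\<close>, and in the continuity proof it
  makes closed the set of pairs at which \<open>H\<close> is defined to be the identity.\<close>

lemma openin_\<rho>_image:
  assumes "openin M W" "W \<subseteq> N"
  shows "openin (prod_topology M (top_of_set {0..1})) {(x, t). t \<in> {0<..1} \<and> x \<in> \<rho> t ` W}"
proof (rule openin_isotopy_image[OF assms(1)])
  have "W \<times> {0<..1} \<subseteq> V \<times> {0..1::real}" using assms N_subset by auto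
  moreover have "continuous_map (subtopology (prod_topology M euclideanreal) (V \<times> {0..1})) M (\<lambda>(x, t). \<rho> t x)"
    using \<rho>_continuous continuous_map_into_fulltopology by (metis subtopology_Times)
  ultimately show "continuous_map (prod_topology (subtopology M W) (top_of_set {0<..1})) M (\<lambda>(x, t). \<rho> t x)"
    unfolding subtopology_Times[symmetric] by (rule continuous_map_from_subtopology_mono[rotated])
  show "inj_on (\<rho> t) W" if "t \<in> {0<..1}" for t
    using \<rho>_inj[OF that] assms N_subset inj_on_subset by blast
qed

lemma \<rho>_open:
  assumes "openin M W" "W \<subseteq> N" and t: "t \<in> {0<..1}"
  shows "openin M (\<rho> t ` W)"
proof -
  have "continuous_map M (prod_topology M (top_of_set {0..1})) (\<lambda>x. (x, t))"
    using t by (intro continuous_map_pairedI) auto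
  from openin_continuous_map_preimage[OF this openin_\<rho>_image[OF assms(1,2)]]
  have "openin M {x \<in> topspace M. x \<in> \<rho> t ` W}" using t by simp
  moreover have "\<rho> t ` W \<subseteq> topspace M" using \<rho>_in[of t] t assms N_subset V_subset by force
  then have "{x \<in> topspace M. x \<in> \<rho> t ` W} = \<rho> t ` W" by auto
  ultimately show ?thesis by simp
qed

text \<open>The image is open in the manifold and lies in \<open>V\<close>. Consequently
  \<open>H t\<close> is conjugated only at interior points of \<open>V\<close>, where being a local
  diffeomorphism has its usual meaning.\<close>

lemma \<rho>_N_subset: "t \<in> {0<..1} \<Longrightarrow> \<rho> t ` N \<subseteq> N"
  using \<rho>_open[of N t] \<rho>_in[of t] N_subset by (intro interior_of_maximal) (auto simp: image_subset_iff)

lemma \<rho>_inverse_smooth: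
  assumes t: "t \<in> {0<..1}"
  shows "Cr_map M A \<infinity> (\<rho> t ` N) (inv_into N (\<rho> t))"
proof (rule Cr_map_inverse[OF N_open])
  show "Cr_map M A \<infinity> N (\<rho> t)" using \<rho>_smooth[OF t] Cr_map_subset N_subset by blast
  show "inj_on (\<rho> t) N" using \<rho>_inj[OF t] N_subset inj_on_subset by blast
  show "\<exists>D. tangent_map A N (\<rho> t) z D \<and> inj D" if z: "z \<in> N" for z
  proof -
    have "\<forall>z\<in>V. \<exists>D. tangent_map A V (\<rho> t) z D \<and> inj D"
      using \<rho>_embedding[OF t] unfolding closed_Cr_embedding_def by simp
    from bspec[OF this subsetD[OF N_subset z]] obtain D where D: "tangent_map A V (\<rho> t) z D" "inj D" by blast
    have "coord_dom N (\<rho> t) c d \<subseteq> coord_dom V (\<rho> t) c d" for c d :: "('a, 'b) chart"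
      using N_subset by (auto simp: coord_dom_eq)
    then have "tangent_map A N (\<rho> t) z D"
      using D(1) unfolding tangent_map_def by (meson has_derivative_subset)
    then show ?thesis using D(2) by blast
  qed
qed (rule \<rho>_open[OF _ _ t])

lemma closedin_\<rho>_closure:
  assumes t: "t \<in> {0<..1}"
  shows "closedin M (\<rho> t ` (M closure_of U))"
proof -
  have emb: "homeomorphic_map (subtopology M V) (subtopology (subtopology M V) (\<rho> t ` V)) (\<rho> t)"
    and cl: "closedin (subtopology M V) (\<rho> t ` V)"
    using \<rho>_embedding[OF t] V_subset by (auto simp: closed_Cr_embedding_def embedding_map_def Int_absorb1)
  have "closedin (subtopology M V) (M closure_of U)"
    using U N_subset by (intro closedin_subset_topspace) auto
  then have "closedin (subtopology (subtopology M V) (\<rho> t ` V)) (\<rho> t ` (M closure_of U))"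
    using homeomorphic_imp_closed_map[OF emb] by (simp add: closed_map_def)
  then show ?thesis using cl V_closed closedin_trans_full by blast
qed

lemma \<rho>_closure_subset: "\<rho> t ` (M closure_of U) \<subseteq> \<rho> t ` N"
  using U by blast

text \<open>On \<open>\<rho> t\<close>
  N\<open>the map is a composite of smooth maps, and off\<close>\<rho> t
  \<open>(M closure_of U)\<close> it is the identity. The first set is open in the manifold, the
  second only relative to \<open>V\<close>, which is the situation of
  \<open>Ck_on_glue\<close>.\<close>

lemma H_smooth:
  assumes t: "t \<in> {0<..1}"
  shows "Cr_map M A \<infinity> V (H t)"
proof -
  let ?Q = "\<rho> t ` N" and ?O = "topspace M - \<rho> t ` (M closure_of U)"
  have Q: "openin M ?Q" using \<rho>_open[OF _ _ t] by simp
  have O': "openin M ?O" using closedin_\<rho>_closure[OF t] by blast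
  have QV: "?Q \<subseteq> V" using \<rho>_N_subset[OF t] N_subset by blast
  have "Cr_map M A \<infinity> ?Q (\<lambda>x. h (inv_into N (\<rho> t) x))"
    by (rule Cr_map_compose[OF Q \<rho>_inverse_smooth[OF t] subset_trans[OF _ N_subset] h_smooth]) (auto intro: inv_into_into)
  then have "Cr_map M A \<infinity> ?Q (\<lambda>x. \<rho> t (h (inv_into N (\<rho> t) x)))"
  proof (rule Cr_map_compose[OF Q _ _ \<rho>_smooth[OF t]], intro image_subsetI)
    show "h (inv_into N (\<rho> t) x) \<in> V" if "x \<in> ?Q" for x
      using inv_into_into[OF that] N_subset by (intro h_in) blast
  qed
  then have smQ: "Cr_map M A \<infinity> ?Q (H t)"
    by (rule Cr_map_cong) (use QV t in \<open>auto simp: H_def\<close>)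
  then have contQ: "continuous_map (subtopology M ?Q) M (H t)" by (simp add: Cr_map_def)
  have id: "H t x = x" if "x \<in> V \<inter> ?O" for x using H_outside[of x t] that t by auto
  have cover: "x \<in> ?Q \<or> x \<in> ?O" if "x \<in> V" for x using that V_subset \<rho>_closure_subset by blast
  have "continuous_map (subtopology M V) M (H t)"
    unfolding continuous_map_def topspace_V
  proof (intro conjI allI impI)
    show "H t \<in> V \<rightarrow> topspace M" using H_in[of t] t V_subset by auto
    fix W assume W: "openin M W"
    have id': "x \<in> V \<Longrightarrow> x \<in> ?O \<Longrightarrow> H t x \<in> W \<longleftrightarrow> x \<in> W" for x using id by simp
    have "{x \<in> V. H t x \<in> W} = V \<inter> ({x \<in> ?Q. H t x \<in> W} \<union> (?O \<inter> W))"
      using id' cover QV by blast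
    then show "openin (subtopology M V) {x \<in> V. H t x \<in> W}"
      using openin_preimage[OF Q contQ W] O' W by (auto intro!: openin_subtopology_Int2 simp del: Diff_subset)
  qed
  moreover have "Ck_on k (coord_dom V (H t) c d) (coord_map (H t) c d)" if c: "c \<in> A" and d: "d \<in> A" for c d k
  proof (rule Ck_on_glue)
    let ?D1 = "coord_dom ?Q (H t) c d" and ?D2 = "coord_dom (V \<inter> ?O) (H t) c d"
    show "open ?D1" using open_coord_dom[OF Q contQ c d] .
    show "?D1 \<subseteq> coord_dom V (H t) c d" using QV by (auto simp: coord_dom_eq)
    have "{x \<in> V \<inter> fst c. H t x \<in> fst d} =
        {x \<in> ?Q \<inter> fst c. H t x \<in> fst d} \<union> {x \<in> (V \<inter> ?O) \<inter> fst c. H t x \<in> fst d}"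
      using QV cover by blast
    then show "coord_dom V (H t) c d = ?D1 \<union> ?D2" unfolding coord_dom_eq by (simp only: image_Un)
    have "?D2 = coord_dom V (H t) c d \<inter> snd c ` (fst c \<inter> ?O)"
      using chart_inj[OF c] by (auto simp: coord_dom_eq inj_on_def)
    moreover have "open (snd c ` (fst c \<inter> ?O))" using chart_open_image[OF c] chart_openin[OF c] O' by blast
    ultimately show "openin (top_of_set (coord_dom V (H t) c d)) ?D2" by (metis openin_open_Int)
    show "Ck_on k ?D1 (coord_map (H t) c d)" using smQ c d by (auto simp: Cr_map_def Cr_on_infinity)
    have "Cr_map M A \<infinity> (V \<inter> ?O) (H t)"
      by (rule Cr_map_cong[OF Cr_map_id]) (use id in auto)
    then show "Ck_on k ?D2 (coord_map (H t) c d)" using c d by (auto simp: Cr_map_def Cr_on_infinity)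
  qed
  ultimately show ?thesis by (auto simp: Cr_map_def Cr_on_infinity)
qed

text \<open>A singular point in the image of the closure of \<open>U\<close> is
  \<open>\<rho> t y\<close> with \<open>y\<close> interior and singular, so an open neighbourhood
  \<open>B\<close> on which \<open>h\<close> is a diffeomorphism can be carried over by
  \<open>\<rho> t\<close>. All other points have a neighbourhood on which \<open>H t\<close> is the
  identity.\<close>

lemma H_local_diffeo:
  assumes t: "t \<in> {0<..1}" and \<omega>: "\<omega> \<in> \<Sigma>" "z \<in> \<omega>" "z \<in> V"
  shows "local_diffeo_at M A V (H t) z"
proof (cases "z \<in> \<rho> t ` (M closure_of U)")
  case True
  have "\<exists>W. openin M W \<and> z \<in> W \<and> W \<subseteq> V \<and> openin M (H t ` W) \<and> inj_on (H t) W \<and>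
               Cr_map M A \<infinity> W (H t) \<and> Cr_map M A \<infinity> (H t ` W) (inv_into W (H t))"
  proof -
    obtain y where y: "y \<in> N" "z = \<rho> t y" using True U by blast
    then obtain \<omega>' where \<omega>': "\<omega>' \<in> \<P>" "y \<in> \<omega>'" "\<omega>' \<subseteq> V" using element_at N_subset by blast
    then have "\<rho> t ` \<omega>' = \<omega>"
      using \<rho>_element[OF t \<omega>'(1,3)] elements_eq[of "\<rho> t ` \<omega>'" \<omega> z] \<omega> \<Sigma>_subset y by auto
    \<comment> \<open>Here it matters that regular elements go to regular ones: the image of
      \<open>\<omega>'\<close> is the singular element \<open>\<omega>\<close>, so
      \<open>\<omega>'\<close> cannot be regular.\<close>
    then have "\<omega>' \<in> \<Sigma>" using \<rho>_regular[OF t, of \<omega>'] \<omega>' \<omega> by auto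
    then have "local_diffeo_at M A V h y" using h \<omega>' by (auto simp: \<E>_def)
    then obtain B where B: "openin M B" "y \<in> B" "B \<subseteq> V" "openin M (h ` B)" "inj_on h B"
      "Cr_map M A \<infinity> (h ` B) (inv_into B h)"
      using y by (auto simp: local_diffeo_at_def)
    have BN: "B \<subseteq> N" using B by (simp add: interior_of_maximal)
    have hBN: "h ` B \<subseteq> N" using B h_in by (intro interior_of_maximal) auto
    let ?W = "\<rho> t ` B"
    have img: "H t ` ?W = \<rho> t ` (h ` B)"
      using H_conj[OF t] B by (force simp: image_image)
    have inj: "inj_on (\<rho> t) N" using \<rho>_inj[OF t] N_subset inj_on_subset by blast
    have W: "openin M ?W" and HW: "openin M (H t ` ?W)"
      using \<rho>_open[OF B(1) BN t] \<rho>_open[OF B(4) hBN t] img by auto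
    have WV: "?W \<subseteq> V" using \<rho>_in[of t] t B by auto
    have injW: "inj_on (H t) ?W"
    proof (rule inj_onI)
      fix x x' assume "x \<in> ?W" "x' \<in> ?W" and eq: "H t x = H t x'"
      then obtain b b' where b: "b \<in> B" "b' \<in> B" "x = \<rho> t b" "x' = \<rho> t b'" by blast
      then have "\<rho> t (h b) = \<rho> t (h b')" using eq H_conj[OF t] B by (metis subsetD)
      then have "h b = h b'" using inj hBN b by (metis image_subset_iff inj_onD)
      then show "x = x'" using b B(5) by (metis inj_onD)
    qed
    have inv: "inv_into N (\<rho> t) (\<rho> t (h b)) = h b" "inv_into B h (h b) = b" if "b \<in> B" for b
      using that inj hBN B(5) by auto
    have "Cr_map M A \<infinity> (H t ` ?W) (inv_into N (\<rho> t))"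
      using \<rho>_inverse_smooth[OF t] by (rule Cr_map_subset) (use img hBN in auto)
    then have "Cr_map M A \<infinity> (H t ` ?W) (\<lambda>x. inv_into B h (inv_into N (\<rho> t) x))"
    proof (rule Cr_map_compose[OF HW _ _ B(6)])
      show "inv_into N (\<rho> t) ` H t ` ?W \<subseteq> h ` B" unfolding img using hBN inj by auto
    qed
    then have "Cr_map M A \<infinity> (H t ` ?W) (\<lambda>x. \<rho> t (inv_into B h (inv_into N (\<rho> t) x)))"
    proof (rule Cr_map_compose[OF HW _ _ \<rho>_smooth[OF t]])
      show "(\<lambda>x. inv_into B h (inv_into N (\<rho> t) x)) ` H t ` ?W \<subseteq> V"
        unfolding img using inv B(3) by auto
    qed
    then have "Cr_map M A \<infinity> (H t ` ?W) (inv_into ?W (H t))"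
    proof (rule Cr_map_cong)
      fix x assume "x \<in> H t ` ?W"
      then obtain b where b: "b \<in> B" "x = H t (\<rho> t b)" by blast
      then have "x = \<rho> t (h b)" "h b \<in> N" using H_conj[OF t] B hBN by auto
      then have "\<rho> t (inv_into B h (inv_into N (\<rho> t) x)) = \<rho> t b" using inj b B(5) by simp
      also have "\<dots> = inv_into ?W (H t) x" using b injW by simp
      finally show "\<rho> t (inv_into B h (inv_into N (\<rho> t) x)) = inv_into ?W (H t) x" .
    qed
    then show ?thesis
      using W HW WV injW y B Cr_map_subset[OF H_smooth[OF t] WV] by (intro exI[of _ ?W]) auto
  qed
  moreover have "z \<in> N" using True \<rho>_closure_subset \<rho>_N_subset[OF t] by blast
  ultimately show ?thesis by (simp add: local_diffeo_at_def)
next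
  case False
  show ?thesis
  proof (rule local_diffeo_at_identity)
    show "openin M (topspace M - \<rho> t ` (M closure_of U))" using closedin_\<rho>_closure[OF t] by blast
    show "z \<in> topspace M - \<rho> t ` (M closure_of U)" using False \<omega> V_subset by blast
    show "H t x = x" if "x \<in> V \<inter> (topspace M - \<rho> t ` (M closure_of U))" for x
      using H_outside[of x t] that t by auto
  qed (rule \<omega>(3))
qed

lemma H_in_\<E>:
  assumes "t \<in> {0..1}" shows "H t \<in> \<E> M A \<P> \<Sigma> V"
proof (cases "t = 0")
  case False
  then have "t \<in> {0<..1}" using assms by auto
  then have "H t \<in> Cr_maps M A \<infinity> V"
    using H_smooth[of t] H_in[OF assms] V_subset by (auto simp: Cr_maps_def PiE_def H_def extensional_def)
  then show ?thesis
    using H_element[OF assms] H_local_diffeo \<open>t \<in> {0<..1}\<close> by (auto simp: \<E>_def)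
qed (simp add: H_0 identity_in_\<E> V_subset)

end

section \<open>Continuity of the isotopy in the weak \<open>C\<^sup>0\<close> topology\<close>

context contraction_isotopy begin

lemma continuous_map_\<rho>:
  "continuous_map (prod_topology (subtopology M V) (top_of_set {0..1})) (subtopology M V) (\<lambda>p. \<rho> (snd p) (fst p))"
  using \<rho>_continuous by (simp add: case_prod_unfold)

text \<open>The graph of \<open>H\<close> over a saturated compact set \<open>C\<close> is the union of the image of \<open>C \<times> [0, 1]\<close>
  under \<open>(y, t) \<mapsto> (\<rho> t y, t, \<rho> t (h y))\<close> and of the part of the diagonal lying over the closed set
  where \<open>x \<notin> \<rho> t ` N\<close>. It is therefore compact, also near \<open>t = 0\<close>.\<close>

lemma openin_times_H:
  assumes K: "compactin M K" "K \<subseteq> V"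
    and G: "openin (prod_topology (subtopology M K) (subtopology M V)) G"
  shows "openin (top_of_set {0..1}) {t \<in> {0..1}. \<forall>x\<in>K. (x, H t x) \<in> G}"
proof -
  let ?I = "top_of_set {0..1::real}"
  \<comment> \<open>The saturation of \<open>K\<close> by fibres of \<open>\<rho> 0\<close>. It
    contains, for all times at once, every \<open>y\<close> with \<open>\<rho> t y \<in> K\<close>,
    because \<open>\<rho> t\<close> preserves fibres; properness makes it compact.\<close>
  define C where "C = {x \<in> V. \<rho> 0 x \<in> \<rho> 0 ` K}"
  have cont: "continuous_map (subtopology M V) (subtopology M V) (\<rho> t)" if "t \<in> {0..1}" for t
  proof -
    have "continuous_map (subtopology M V) (prod_topology (subtopology M V) ?I) (\<lambda>x. (x, t))"
      using that by (intro continuous_map_pairedI) auto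
    from continuous_map_compose[OF this continuous_map_\<rho>] show ?thesis by (simp add: o_def)
  qed
  have "compactin M (\<rho> 0 ` K)"
    using image_compactin[OF _ cont[of 0]] K by (auto simp: compactin_subtopology)
  moreover have "\<rho> 0 ` K \<subseteq> Z" using K \<rho>_0 by auto
  ultimately have C: "compactin M C" unfolding C_def using \<rho>_proper by blast
  have CV: "C \<subseteq> V" by (auto simp: C_def)
  \<comment> \<open>The forbidden pairs. The times to be excluded are those at which the graph over
    \<open>K\<close> meets \<open>B\<close>, and they are to be shown to form a closed set.\<close>
  define B where "B = K \<times> V - G"
  have "closedin (prod_topology (subtopology M K) (subtopology M V)) B"
    unfolding B_def using G K V_subset by (intro closedin_diff) (auto simp: closedin_prod_Times_iff Int_absorb1)
  moreover have "prod_topology (subtopology M K) (subtopology M V) =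
      subtopology (prod_topology (subtopology M V) (subtopology M V)) (K \<times> V)"
    using K V_subset by (simp add: prod_topology_subtopology subtopology_subtopology Int_absorb1 Int_absorb2 Times_Int_Times)
  moreover have "closedin (prod_topology (subtopology M V) (subtopology M V)) (K \<times> V)"
    using K compactin_imp_closedin[OF Hausdorff K(1)] V_subset
    by (auto simp: closedin_prod_Times_iff Int_absorb1 intro!: closedin_subset_topspace)
  ultimately have B: "closedin (prod_topology (subtopology M V) (subtopology M V)) B"
    using closedin_trans_full by metis
  let ?X1 = "prod_topology (subtopology M C) ?I" and ?X2 = "prod_topology (subtopology M K) ?I"
  define A1 where "A1 = {p \<in> C \<times> {0..1}. (\<rho> (snd p) (fst p), \<rho> (snd p) (h (fst p))) \<in> B}"
  define A2 where "A2 = {p \<in> K \<times> {0..1}. \<not> (0 < snd p \<and> fst p \<in> \<rho> (snd p) ` N) \<and> (fst p, fst p) \<in> B}"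
  have incl: "continuous_map ?X1 (subtopology M V) fst" "continuous_map ?X2 (subtopology M V) fst"
    using CV K continuous_map_fst[of "subtopology M C" ?I] continuous_map_fst[of "subtopology M K" ?I] V_subset
    by (auto simp: continuous_map_in_subtopology)
  have tops: "topspace ?X1 = C \<times> {0..1}" "topspace ?X2 = K \<times> {0..1}"
    using CV K V_subset by auto
  have h_cont: "continuous_map (subtopology M V) (subtopology M V) h"
    using h_smooth h_in V_subset by (auto simp: Cr_map_def continuous_map_in_subtopology)
  have "closedin ?X1 A1"
  proof -
    have 1: "continuous_map ?X1 (subtopology M V) (\<lambda>p. \<rho> (snd p) (fst p))"
      using continuous_map_compose[OF continuous_map_pairedI[OF incl(1) continuous_map_snd] continuous_map_\<rho>]
      by (simp add: o_def)
    have "continuous_map ?X1 (subtopology M V) (\<lambda>p. h (fst p))"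
      using continuous_map_compose[OF incl(1) h_cont] by (simp add: o_def)
    then have 2: "continuous_map ?X1 (subtopology M V) (\<lambda>p. \<rho> (snd p) (h (fst p)))"
      using continuous_map_compose[OF continuous_map_pairedI[OF _ continuous_map_snd] continuous_map_\<rho>]
      by (simp add: o_def)
    show ?thesis
      using closedin_continuous_map_preimage[OF continuous_map_pairedI[OF 1 2] B]
      unfolding A1_def tops .
  qed
  \<comment> \<open>Projection along a compact factor is a closed map; this is where compactness of
    \<open>C\<close> is used.\<close>
  then have A1: "closedin ?I (snd ` A1)"
    using Abstract_Topological_Spaces.closed_map_snd[of "subtopology M C" ?I] C
    by (simp add: closed_map_def compact_space_subtopology)
  have "closedin ?X2 A2"
  proof -
    have "continuous_map ?X2 (prod_topology M ?I) (\<lambda>p. (fst p, snd p))"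
      using incl(2) by (intro continuous_map_pairedI continuous_map_snd) (auto simp: continuous_map_in_subtopology)
    from openin_continuous_map_preimage[OF this openin_\<rho>_image[OF N_open]]
    have "openin ?X2 {p \<in> K \<times> {0..1}. 0 < snd p \<and> fst p \<in> \<rho> (snd p) ` N}"
      unfolding tops by (rule back_subst[of "openin ?X2"]) auto
    moreover have "closedin ?X2 {p \<in> K \<times> {0..1}. (fst p, fst p) \<in> B}"
      using closedin_continuous_map_preimage[OF continuous_map_pairedI[OF incl(2) incl(2)] B] unfolding tops .
    moreover have "A2 = {p \<in> K \<times> {0..1}. (fst p, fst p) \<in> B} - {p \<in> K \<times> {0..1}. 0 < snd p \<and> fst p \<in> \<rho> (snd p) ` N}"
      by (auto simp: A2_def)
    ultimately show ?thesis by (simp add: closedin_diff)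
  qed
  then have A2: "closedin ?I (snd ` A2)"
    using Abstract_Topological_Spaces.closed_map_snd[of "subtopology M K" ?I] K
    by (simp add: closed_map_def compact_space_subtopology)
  have "{t \<in> {0..1}. \<forall>x\<in>K. (x, H t x) \<in> G} = {0..1} - (snd ` A1 \<union> snd ` A2)"
  proof (intro set_eqI iffI)
    fix t assume "t \<in> {t \<in> {0..1}. \<forall>x\<in>K. (x, H t x) \<in> G}"
    then have t: "t \<in> {0..1}" and G: "\<And>x. x \<in> K \<Longrightarrow> (x, H t x) \<in> G" by auto
    have "t \<notin> snd ` A1"
    proof
      assume "t \<in> snd ` A1"
      then obtain y where y: "y \<in> C" "(\<rho> t y, \<rho> t (h y)) \<in> B" by (auto simp: A1_def)
      then have yV: "y \<in> V" and Ky: "\<rho> t y \<in> K" by (auto simp: C_def B_def)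
      \<comment> \<open>At \<open>t = 0\<close> no conjugation takes place, yet the formula
        persists: \<open>\<rho> 0 (h y) = \<rho> 0 y\<close>, so the limiting pairs lie on the
        diagonal, which is the graph of \<open>H 0\<close>.\<close>
      have "H t (\<rho> t y) = \<rho> t (h y)"
      proof (cases "t = 0")
        case True
        then show ?thesis using H_0 K Ky \<rho>_0_h[OF yV] by auto
      next
        case False
        then show ?thesis using H_conj yV t by auto
      qed
      then show False using G[OF Ky] y by (simp add: B_def)
    qed
    moreover have "t \<notin> snd ` A2"
    proof
      assume "t \<in> snd ` A2"
      then obtain x where x: "x \<in> K" "\<not> (0 < t \<and> x \<in> \<rho> t ` N)" "(x, x) \<in> B" by (auto simp: A2_def)
      then have "H t x = x" using K by (auto simp: H_def)
      then show False using G[OF x(1)] x by (simp add: B_def)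
    qed
    ultimately show "t \<in> {0..1} - (snd ` A1 \<union> snd ` A2)" using t by blast
  next
    fix t assume "t \<in> {0..1} - (snd ` A1 \<union> snd ` A2)"
    then have t: "t \<in> {0..1}" and n1: "t \<notin> snd ` A1" and n2: "t \<notin> snd ` A2" by auto
    have "(x, H t x) \<in> G" if x: "x \<in> K" for x
    proof (rule ccontr)
      assume nG: "(x, H t x) \<notin> G"
      have xV: "x \<in> V" using K x by blast
      have B: "(x, H t x) \<in> B" using nG x H_in[OF t xV] by (simp add: B_def)
      show False
      proof (cases "0 < t \<and> x \<in> \<rho> t ` N")
        case True
        then obtain y where y: "y \<in> N" "x = \<rho> t y" by blast
        then have yV: "y \<in> V" using N_subset by blast
        have "\<rho> 0 y \<in> \<rho> 0 ` K" using \<rho>_0_\<rho>[OF yV t] x y by (metis imageI)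
        then have "y \<in> C" using yV by (simp add: C_def)
        moreover have "H t x = \<rho> t (h y)" using H_conj[of t y] yV y True t by auto
        ultimately have "(y, t) \<in> A1" using B y t by (simp add: A1_def)
        then show False using n1 by force
      next
        case False
        then have "H t x = x" using xV by (auto simp: H_def)
        then have "(x, t) \<in> A2" using False B x t by (simp add: A2_def)
        then show False using n2 by force
      qed
    qed
    then show "t \<in> {t \<in> {0..1}. \<forall>x\<in>K. (x, H t x) \<in> G}" using t by blast
  qed
  then show ?thesis using A1 A2 by (auto intro!: openin_diff)
qed

lemma H_in_Cr_maps_0: "t \<in> {0..1} \<Longrightarrow> H t \<in> Cr_maps M A 0 V"
  using H_in_\<E>[of t] by (auto simp: \<E>_def Cr_maps_def Cr_map_def Cr_on_def)

text \<open>For order 0 the only list of directions is the empty one. A subbasic neighbourhood then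
  asks just that the pairs \<open>(x, H t x)\<close> with \<open>x \<in> K\<close> lie in a fixed
  open set, which reduces the claim to \<open>openin_times_H\<close>.\<close>

lemma H_continuous:
  "continuous_map (top_of_set {0..1}) (weak_Whitney_topology M A 0 V) H"
  unfolding weak_Whitney_topology_def continuous_on_generated_topo_iff
proof (intro conjI allI impI)
  show "H ` topspace (top_of_set {0..1}) \<subseteq> \<Union> (insert (Cr_maps M A 0 V)
       {Whitney_nbhd M A 0 V f c d K k \<epsilon> | f c d K k \<epsilon>.
          f \<in> Cr_maps M A 0 V \<and> c \<in> A \<and> d \<in> A \<and> compactin M K \<and> K \<subseteq> V \<inter> fst c \<and>
          f ` K \<subseteq> fst d \<and> enat k \<le> 0 \<and> 0 < \<epsilon>})"
    using H_in_Cr_maps_0 by auto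
next
  fix W assume "W \<in> insert (Cr_maps M A 0 V)
       {Whitney_nbhd M A 0 V f c d K k \<epsilon> | f c d K k \<epsilon>.
          f \<in> Cr_maps M A 0 V \<and> c \<in> A \<and> d \<in> A \<and> compactin M K \<and> K \<subseteq> V \<inter> fst c \<and>
          f ` K \<subseteq> fst d \<and> enat k \<le> 0 \<and> 0 < \<epsilon>}"
  then consider "W = Cr_maps M A 0 V"
    | f c d K \<epsilon> where "W = Whitney_nbhd M A 0 V f c d K 0 \<epsilon>" "f \<in> Cr_maps M A 0 V" "c \<in> A" "d \<in> A"
        "compactin M K" "K \<subseteq> V \<inter> fst c" "f ` K \<subseteq> fst d" "0 < \<epsilon>"
    by (auto simp: zero_enat_def)
  then show "openin (top_of_set {0..1}) (H -` W \<inter> topspace (top_of_set {0..1}))"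
  proof cases
    case 1
    then have "H -` W \<inter> topspace (top_of_set {0..1}) = {0..1}" using H_in_Cr_maps_0 by auto
    then show ?thesis by simp
  next
    case 2
    have KV: "K \<subseteq> V" and KM: "K \<subseteq> topspace M" using 2 V_subset by auto
    define G where "G = {p \<in> K \<times> (V \<inter> fst d). norm (snd d (f (fst p)) - snd d (snd p)) < \<epsilon>}"
    let ?Y = "prod_topology (subtopology M K) (subtopology M V)"
    let ?Y' = "prod_topology (subtopology M K) (subtopology M (V \<inter> fst d))"
    have openG: "openin ?Y G"
    proof -
      have "continuous_map (subtopology M V) M f" using 2 by (auto simp: Cr_maps_def Cr_map_def)
      then have "continuous_map (subtopology M K) (subtopology M (fst d)) f"
        using continuous_map_from_subtopology_mono[OF _ KV] 2 KM by (auto simp: continuous_map_in_subtopology)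
      from continuous_map_compose[OF continuous_map_compose[OF continuous_map_fst this] chart_continuous[OF 2(4)]]
      have 1: "continuous_map ?Y' euclidean (\<lambda>p. snd d (f (fst p)))" by (simp add: o_def)
      have "continuous_map (subtopology M (V \<inter> fst d)) (subtopology M (fst d)) (\<lambda>x. x)"
        by (auto simp: continuous_map_in_subtopology continuous_map_from_subtopology)
      from continuous_map_compose[OF continuous_map_compose[OF continuous_map_snd this] chart_continuous[OF 2(4)]]
      have s2: "continuous_map ?Y' euclidean (\<lambda>p. snd d (snd p))" by (simp add: o_def)
      have "continuous_map ?Y' euclideanreal (\<lambda>p. norm (snd d (f (fst p)) - snd d (snd p)))"
        by (intro continuous_map_norm continuous_map_diff 1 s2)
      from openin_continuous_map_preimage[OF this, of "{..<\<epsilon>}"]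
      have "openin ?Y' G" using KM V_subset by (simp add: G_def Int_absorb1 Int_assoc[symmetric])
      moreover have "?Y' = subtopology ?Y (K \<times> (V \<inter> fst d))"
        using KM by (simp add: prod_topology_subtopology subtopology_subtopology Int_absorb1 Int_absorb2 Times_Int_Times Int_ac)
      moreover have "openin ?Y (K \<times> (V \<inter> fst d))"
        using KM chart_openin[OF 2(4)] openin_subtopology_refl[of M K]
        by (auto simp: openin_prod_Times_iff intro!: openin_subtopology_Int2)
      ultimately show ?thesis using openin_trans_full by metis
    qed
    from openin_times_H[OF 2(5) KV openG]
    have "openin (top_of_set {0..1}) {t \<in> {0..1}. \<forall>x\<in>K. (x, H t x) \<in> G}" .
    moreover have "H t \<in> W \<longleftrightarrow> (\<forall>x\<in>K. (x, H t x) \<in> G)" if "t \<in> {0..1}" for t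
      using H_in_Cr_maps_0[OF that] H_in[OF that] 2 KV
      by (auto simp: Whitney_nbhd_def G_def coord_map_eq chart_inv image_subset_iff subset_iff)
    then have "H -` W \<inter> topspace (top_of_set {0..1}) = {t \<in> {0..1}. \<forall>x\<in>K. (x, H t x) \<in> G}" by auto
    ultimately show ?thesis by simp
  qed
qed

lemma h_in_\<E>_id: "h \<in> \<E>_id M A \<P> \<Sigma> V 0"
proof -
  have "pathin (subtopology (weak_Whitney_topology M A 0 V) (\<E> M A \<P> \<Sigma> V)) H"
    using H_continuous H_in_\<E> by (auto simp: pathin_def continuous_map_in_subtopology)
  then show ?thesis
    unfolding \<E>_id_def path_component_of_def using H_0 H_1 by auto
qed

end

section \<open>Discrete manifolds and the first claim\<close>

lemma contraction_discrete:
  fixes \<rho> :: "real \<Rightarrow> 'a \<Rightarrow> 'a"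
  assumes disc: "\<And>x. x \<in> topspace M \<Longrightarrow> openin M {x}"
    and V: "V \<subseteq> topspace M"
    and cont: "continuous_map (prod_topology (subtopology M V) (top_of_set {0..1::real})) (subtopology M V) (\<lambda>(x, t). \<rho> t x)"
    and x: "x \<in> V"
  shows "\<rho> 0 x = \<rho> 1 x"
proof -
  have "continuous_map (top_of_set {0..1::real}) (prod_topology (subtopology M V) (top_of_set {0..1})) (\<lambda>t. (x, t))"
    using x V by (intro continuous_map_pairedI) auto
  from continuous_map_compose[OF this cont]
  have c: "continuous_map (top_of_set {0..1}) M (\<lambda>t. \<rho> t x)"
    by (auto simp: o_def continuous_map_in_subtopology)
  have "connectedin (top_of_set {0..1::real}) {0..1}" by (simp add: connectedin_subtopology)
  then have conn: "connectedin M ((\<lambda>t. \<rho> t x) ` {0..1})" by (rule connectedin_continuous_map_image[OF c])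
  have sub: "\<rho> t x \<in> topspace M" if "t \<in> {0..1}" for t using c that by (auto simp: continuous_map_def)
  have "openin M (topspace M - {\<rho> 1 x})"
    by (subst openin_subopen) (use disc in blast)
  moreover have r1: "\<rho> 1 x \<in> topspace M" using sub[of 1] by simp
  ultimately have "closedin M {\<rho> 1 x}" by (simp add: closedin_def)
  from connectedin_clopen_cases[OF conn this disc[OF r1]]
  have "(\<lambda>t. \<rho> t x) ` {0..1} \<subseteq> {\<rho> 1 x}"
    unfolding disjnt_def by (metis atLeastAtMost_iff disjoint_insert(1) image_eqI order_refl zero_le_one)
  then have "\<rho> 0 x \<in> {\<rho> 1 x}" by (rule subsetD) simp
  then show ?thesis by simp
qed

lemma \<E>_subset_topspace: "\<E> M A \<P> \<Sigma> V \<subseteq> topspace (weak_Whitney_topology M A r V)"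
proof -
  have "\<E> M A \<P> \<Sigma> V \<subseteq> Cr_maps M A r V"
    by (auto simp: \<E>_def Cr_maps_def Cr_map_def Cr_on_def)
  then show ?thesis unfolding weak_Whitney_topology_def topology_generated_by_topspace Union_insert
    by (rule le_supI1)
qed

lemma fixed_outside_in_\<E>_id:
  fixes M :: "'a topology" and A :: "('a, 'b::euclidean_space) chart set"
  assumes "smooth_manifold M A" "singular_partition M \<P> \<Sigma>" "\<forall>z\<in>Z. {z} \<in> \<Sigma>"
    "invariant_contraction M A \<P> \<Sigma> \<infinity> Z V" "h \<in> \<E> M A \<P> \<Sigma> V" "fixed_outside_nbhd M Z V h"
  shows "h \<in> \<E>_id M A \<P> \<Sigma> V 0"
proof -
  from assms(1) obtain E where Haus: "Hausdorff_space M" and E: "E = UNIV \<or> E = {0}"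
    and chart: "\<forall>c\<in>A. is_chart M E c" and cover: "(\<Union>c\<in>A. fst c) = topspace M"
    and compat: "\<forall>c\<in>A. \<forall>d\<in>A. compatible c d"
    unfolding smooth_manifold_def by (elim conjE exE) (rule that)
  from assms(4) obtain \<rho> :: "real \<Rightarrow> 'a \<Rightarrow> 'a" where V: "closedin M V" "invariant_set M \<P> V"
    and \<rho>: "continuous_map (prod_topology (subtopology M V) (top_of_set {0..1})) (subtopology M V) (\<lambda>(x, t). \<rho> t x)"
      "\<forall>x\<in>V. \<rho> 1 x = x" "\<rho> 0 ` V = Z" "\<forall>z\<in>Z. \<rho> 0 z = z"
      "\<forall>K\<subseteq>Z. compactin M K \<longrightarrow> compactin M {x\<in>V. \<rho> 0 x \<in> K}"
      "\<forall>t\<in>{0<..1}. closed_Cr_embedding M A \<infinity> V (\<rho> t) \<and>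
           (\<forall>\<omega>\<in>\<P> - \<Sigma>. \<omega> \<subseteq> V \<longrightarrow> \<rho> t ` \<omega> \<in> \<P> - \<Sigma>) \<and>
           (\<forall>\<omega>\<in>\<Sigma>. \<omega> \<subseteq> V \<longrightarrow> \<rho> t ` \<omega> \<in> \<Sigma>)"
      "\<forall>z\<in>Z. invariant_set M \<P> {x\<in>V. \<rho> 0 x = z} \<and>
           (\<forall>t\<in>{0..1}. \<rho> t ` {x\<in>V. \<rho> 0 x = z} \<subseteq> {x\<in>V. \<rho> 0 x = z})"
    unfolding invariant_contraction_def by (elim conjE exE) (rule that)
  from assms(6) obtain U where U: "U \<subseteq> topspace M" "M closure_of U \<subseteq> M interior_of V" "\<forall>x\<in>V - U. h x = x"
    unfolding fixed_outside_nbhd_def by blast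
  show ?thesis
    using E
  proof
    assume "E = UNIV"
    interpret contraction_isotopy M A \<P> \<Sigma> Z V \<rho> U h
      by unfold_locales
        (use Haus chart cover compat assms(2,5) V \<rho> U \<open>E = UNIV\<close> in \<open>simp_all add: compatible_def\<close>)
    show ?thesis by (rule h_in_\<E>_id)
  next
    \<comment> \<open>A zero-dimensional manifold is discrete, so paths are constant, \<open>V = Z\<close> and \<open>h\<close> is the identity.\<close>
    assume E0: "E = {0}"
    have VM: "V \<subseteq> topspace M" using V(1) closedin_subset by blast
    have "openin M {x}" if x: "x \<in> topspace M" for x
    proof -
      obtain c where c: "c \<in> A" "x \<in> fst c" using x cover by blast
      then have op: "openin M (fst c)" and sub: "snd c ` fst c \<subseteq> {0}"
        and hom: "homeomorphic_map (subtopology M (fst c)) (top_of_set (snd c ` fst c)) (snd c)"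
        using bspec[OF chart c(1)] E0 by (auto simp: is_chart_def case_prod_beta openin_contains_ball dest: openin_imp_subset)
      have "inj_on (snd c) (fst c)"
        using homeomorphic_imp_injective_map[OF hom] openin_subset[OF op] by (simp add: Int_absorb1)
      then have "fst c = {x}" using sub c(2) by (auto simp: inj_on_def image_subset_iff)
      then show ?thesis using op by simp
    qed
    then have \<rho>id: "\<rho> 0 x = x" if "x \<in> V" for x
      using contraction_discrete[of M V \<rho> x] VM \<rho>(1,2) that by simp
    then have "V \<subseteq> Z" using \<rho>(3) by (metis image_eqI subsetI)
    have "h = (\<lambda>x\<in>V. x)"
    proof
      fix x
      show "h x = (\<lambda>x\<in>V. x) x"
      proof (cases "x \<in> V")
        case True
        then have "{x} \<in> \<P>" using \<open>V \<subseteq> Z\<close> assms(2,3) by (auto simp: singular_partition_def)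
        then show ?thesis using assms(5) True by (auto simp: \<E>_def)
      next
        case False
        then show ?thesis using assms(5) by (auto simp: \<E>_def Cr_maps_def PiE_def extensional_def)
      qed
    qed
    moreover have "h \<in> topspace (subtopology (weak_Whitney_topology M A 0 V) (\<E> M A \<P> \<Sigma> V))"
      using assms(5) \<E>_subset_topspace by fastforce
    ultimately show ?thesis
      unfolding \<E>_id_def by (simp add: path_component_of_refl)
  qed
qed

section \<open>Elementary smooth functions\<close>

lemma Ck_on_Suc_real:
  assumes "\<And>x. x \<in> D \<Longrightarrow> (f has_real_derivative f' x) (at x within D)" "Ck_on k D f'"
  shows "Ck_on (Suc k) D f"
  unfolding Ck_on.simps
proof (intro exI[of _ "\<lambda>x. (*) (f' x)"] conjI ballI allI)
  show "(f has_derivative (*) (f' x)) (at x within D)" if "x \<in> D" for x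
    using assms(1)[OF that] by (simp add: has_field_derivative_def)
  show "Ck_on k D (\<lambda>x. f' x * v)" for v
    by (rule Ck_on_mult[OF assms(2) Ck_on_const])
qed

lemma Ck_on_powr: "Ck_on k {0<..} (\<lambda>x::real. x powr p)"
proof (induction k arbitrary: p)
  case 0
  show ?case by (auto intro!: continuous_intros)
next
  case (Suc k)
  show ?case
  proof (rule Ck_on_Suc_real)
    show "((\<lambda>x. x powr p) has_real_derivative p * x powr (p - 1)) (at x within {0<..})" if "x \<in> {0<..}" for x
      using has_real_derivative_powr[of x p] that by (auto intro: has_field_derivative_at_within)
    show "Ck_on k {0<..} (\<lambda>x. p * x powr (p - 1))" by (rule Ck_on_mult[OF Ck_on_const Suc])
  qed
qed

lemma Ck_on_cos_sin: "Ck_on k D (cos :: real \<Rightarrow> real) \<and> Ck_on k D (sin :: real \<Rightarrow> real)"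
proof (induction k)
  case 0
  show ?case by (auto intro!: continuous_intros)
next
  case (Suc k)
  have "Ck_on (Suc k) D (cos :: real \<Rightarrow> real)"
    by (rule Ck_on_Suc_real[where f'="\<lambda>x. - sin x"])
       (use Suc Ck_on_minus[of k D sin] in \<open>auto intro!: derivative_eq_intros\<close>)
  moreover have "Ck_on (Suc k) D (sin :: real \<Rightarrow> real)"
    by (rule Ck_on_Suc_real[where f'=cos]) (use Suc in \<open>auto intro!: derivative_eq_intros\<close>)
  ultimately show ?case by blast
qed

lemma Ck_on_cis: "Ck_on k D cis"
proof (rule Ck_on_cong)
  show "Ck_on k D (\<lambda>x. of_real (cos x) + \<i> * of_real (sin x))"
    using Ck_on_cos_sin[of k D]
    by (intro Ck_on_add Ck_on_mult[OF Ck_on_const] Ck_on_bounded_linear_comp[OF bounded_linear_of_real]) auto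
qed (auto simp: complex_eq_iff)

text \<open>Up to linear combinations this family is closed under differentiation, so a single
  induction over the order, for all \<open>n\<close> together, gives smoothness.\<close>

definition flat :: "nat \<Rightarrow> real \<Rightarrow> real" where
  "flat n x = (if 0 < x then exp (- 1 / x) / x ^ n else 0)"

lemma flat_tendsto_0: "((\<lambda>x. exp (- 1 / x) / x ^ n) \<longlongrightarrow> 0) (at_right (0::real))"
proof -
  have "((\<lambda>y. y ^ n / exp y) \<longlongrightarrow> 0) (at_top :: real filter)" by (rule tendsto_power_div_exp_0)
  then have "((\<lambda>x. exp (- 1 / inverse x) / inverse x ^ n) \<longlongrightarrow> 0) (at_top :: real filter)"
    by (simp add: exp_minus field_simps)
  then show ?thesis by (simp add: filterlim_at_right_to_top)
qed

lemma has_real_derivative_flat: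
  "(flat n has_real_derivative flat (n + 2) x - n * flat (n + 1) x) (at x)"
proof -
  consider "x > 0" | "x < 0" | "x = 0" by linarith
  then show ?thesis
  proof cases
    case 1
    have "((\<lambda>x. exp (- 1 / x) / x ^ n) has_real_derivative flat (n + 2) x - n * flat (n + 1) x) (at x)"
      using 1 by (auto intro!: derivative_eq_intros simp: flat_def field_simps power2_eq_square)
        (cases n; simp add: field_simps power2_eq_square)
    then show ?thesis
      by (rule has_field_derivative_transform_within_open[where S="{0<..}"]) (use 1 in \<open>auto simp: flat_def\<close>)
  next
    case 2
    have "((\<lambda>x. 0) has_real_derivative flat (n + 2) x - n * flat (n + 1) x) (at x)"
      using 2 by (simp add: flat_def)
    then show ?thesis
      by (rule has_field_derivative_transform_within_open[where S="{..<0}"]) (use 2 in \<open>auto simp: flat_def\<close>)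
  next
    case 3
    \<comment> \<open>From the right the difference quotient is \<open>flat (Suc n) h\<close>, so
      the limit in \<open>flat_tendsto_0\<close> also yields differentiability at 0.\<close>
    have "((\<lambda>h. flat n h / h) \<longlongrightarrow> 0) (at_right 0)"
      by (rule Lim_transform_eventually[OF flat_tendsto_0[of "Suc n"]])
         (auto simp: flat_def eventually_at_right_less eventually_at_filter mult.commute)
    moreover have "((\<lambda>h. flat n h / h) \<longlongrightarrow> 0) (at_left 0)"
      by (rule Lim_transform_eventually[OF tendsto_const])
         (auto simp: flat_def eventually_at_filter)
    ultimately have "((\<lambda>h. flat n h / h) \<longlongrightarrow> 0) (at 0)" by (simp add: filterlim_split_at)
    then show ?thesis using 3 by (simp add: has_field_derivative_iff flat_def)
  qed
qed

lemma Ck_on_flat: "Ck_on k UNIV (flat n)"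
proof (induction k arbitrary: n)
  case 0
  show ?case
    by (auto intro!: continuous_at_imp_continuous_on DERIV_isCont has_real_derivative_flat simp del: One_nat_def)
next
  case (Suc k)
  show ?case
  proof (rule Ck_on_Suc_real)
    show "(flat n has_real_derivative flat (n + 2) x + - (n * flat (n + 1) x)) (at x within UNIV)" for x
      using has_real_derivative_flat[of n x] by simp
    show "Ck_on k UNIV (\<lambda>x. flat (n + 2) x + - (n * flat (n + 1) x))"
      by (intro Ck_on_add Ck_on_minus[where f="\<lambda>x. n * flat (n + 1) x"] Ck_on_mult[OF Ck_on_const] Suc)
  qed
qed

text \<open>The usual smooth step. The quotient is written with \<open>powr - 1\<close> so that
  \<open>Ck_on_powr\<close> covers it; the base is positive because \<open>3/4 - s\<close> and
  \<open>s - 1/4\<close> are never both nonpositive.\<close>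

definition cutoff :: "real \<Rightarrow> real" where
  "cutoff s = flat 0 (3/4 - s) * (flat 0 (3/4 - s) + flat 0 (s - 1/4)) powr - 1"

lemma Ck_on_cutoff: "Ck_on k UNIV cutoff"
proof -
  have 1: "Ck_on k UNIV (\<lambda>s. flat 0 (3/4 - s))"
  proof (rule Ck_on_compose[where f="\<lambda>s. 3/4 - s", OF subset_UNIV _ Ck_on_flat])
    show "Ck_on k UNIV (\<lambda>s::real. 3/4 - s)"
      using Ck_on_add[OF Ck_on_const[of k UNIV "3/4"] Ck_on_minus[OF Ck_on_bounded_linear[OF bounded_linear_ident]]] by simp
  qed
  have 2: "Ck_on k UNIV (\<lambda>s. flat 0 (s - 1/4))"
  proof (rule Ck_on_compose[where f="\<lambda>s. s - 1/4", OF subset_UNIV _ Ck_on_flat])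
    show "Ck_on k UNIV (\<lambda>s::real. s - 1/4)"
      using Ck_on_add[OF Ck_on_bounded_linear[OF bounded_linear_ident] Ck_on_const[of k UNIV "- (1/4)"]] by simp
  qed
  have "Ck_on k UNIV (\<lambda>s. (flat 0 (3/4 - s) + flat 0 (s - 1/4)) powr - 1)"
  proof (rule Ck_on_compose[where f="\<lambda>s. flat 0 (3/4 - s) + flat 0 (s - 1/4)", OF _ Ck_on_add[OF 1 2] Ck_on_powr])
    show "range (\<lambda>s. flat 0 (3/4 - s) + flat 0 (s - 1/4)) \<subseteq> {0<..}"
      by (auto simp: flat_def add_pos_pos)
  qed
  from Ck_on_mult[OF 1 this] show ?thesis by (simp add: cutoff_def[abs_def])
qed

lemma cutoff_eq_1: "s \<le> 1/4 \<Longrightarrow> cutoff s = 1"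
  by (simp add: cutoff_def flat_def powr_minus)

lemma cutoff_eq_0: "3/4 \<le> s \<Longrightarrow> cutoff s = 0"
  by (simp add: cutoff_def flat_def)

section \<open>Euclidean space as a smooth manifold\<close>

text \<open>Compatibility is tested against the identity chart alone. Charts passing this test are
  compatible with each other through it, and the identity chart belongs to the atlas, whence
  maximality.\<close>

definition euclidean_atlas :: "('b::euclidean_space, 'b) chart set" where
  "euclidean_atlas = {c. is_chart euclidean UNIV c \<and> compatible c (UNIV, \<lambda>x. x)}"

lemma inv_into_UNIV_ident [simp]: "inv_into UNIV (\<lambda>x. x) = (\<lambda>x. x)"
  using inv_id by (simp add: id_def)

lemma compatible_ident:
  "compatible c (UNIV, \<lambda>x. x) \<longleftrightarrow>
    (\<forall>k. Ck_on k (fst c) (snd c)) \<and> (\<forall>k. Ck_on k (snd c ` fst c) (inv_into (fst c) (snd c)))"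
  by (auto simp: compatible_def smooth_transition_eq Cr_on_infinity o_def)

lemma euclidean_atlas_smooth:
  assumes "c \<in> euclidean_atlas"
  shows "Ck_on k (fst c) (snd c)" "Ck_on k (snd c ` fst c) (inv_into (fst c) (snd c))"
  using assms by (auto simp: euclidean_atlas_def compatible_ident)

lemma euclidean_atlas_chart: "c \<in> euclidean_atlas \<Longrightarrow> is_chart euclidean UNIV c"
  by (simp add: euclidean_atlas_def)

lemma euclidean_atlasI:
  fixes \<phi> \<psi> :: "'b::euclidean_space \<Rightarrow> 'b"
  assumes U: "open U" "open (\<phi> ` U)" and inv: "\<And>x. x \<in> U \<Longrightarrow> \<psi> (\<phi> x) = x"
    and smooth: "\<And>k. Ck_on k U \<phi>" "\<And>k. Ck_on k (\<phi> ` U) \<psi>"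
  shows "(U, \<phi>) \<in> euclidean_atlas"
proof -
  have inj: "inj_on \<phi> U" using inv by (metis inj_onI)
  have "homeomorphic_maps (top_of_set U) (top_of_set (\<phi> ` U)) \<phi> \<psi>"
    using Ck_on_continuous[OF smooth(1)] Ck_on_continuous[OF smooth(2)] inv
    by (auto simp: homeomorphic_maps_def continuous_map_in_subtopology)
  then have "homeomorphic_map (top_of_set U) (top_of_set (\<phi> ` U)) \<phi>"
    using homeomorphic_map_maps by blast
  then have "is_chart euclidean UNIV (U, \<phi>)" using U by (simp add: is_chart_def)
  moreover have "Ck_on k (\<phi> ` U) (inv_into U \<phi>)" for k
    using smooth(2) by (rule Ck_on_cong) (use inj inv in auto)
  ultimately show ?thesis using smooth by (auto simp: euclidean_atlas_def compatible_ident)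
qed

lemma open_in_euclidean_atlas: "open U \<Longrightarrow> (U, \<lambda>x. x) \<in> euclidean_atlas"
  by (rule euclidean_atlasI[where \<psi>="\<lambda>x. x"]) (auto intro: Ck_on_bounded_linear bounded_linear_ident)

lemma ident_in_euclidean_atlas: "(UNIV, \<lambda>x. x) \<in> euclidean_atlas"
  by (rule open_in_euclidean_atlas) simp

lemma Union_euclidean_atlas: "(\<Union>c\<in>euclidean_atlas. fst c) = UNIV"
  using ident_in_euclidean_atlas by (metis UNIV_I UN_upper fst_conv subset_UNIV subset_antisym)

lemma euclidean_transition:
  fixes c d :: "('b::euclidean_space, 'b) chart"
  assumes c: "c \<in> euclidean_atlas" and d: "d \<in> euclidean_atlas"
  shows "smooth_transition c d"
proof -
  have inj: "inj_on (snd c) (fst c)"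
    using euclidean_atlas_chart[OF c] homeomorphic_imp_injective_map
    by (fastforce simp: is_chart_def case_prod_beta)
  have "Ck_on k (snd c ` (fst c \<inter> fst d)) (\<lambda>x. snd d (inv_into (fst c) (snd c) x))" for k
  proof (rule Ck_on_compose[OF _ _ euclidean_atlas_smooth(1)[OF d]])
    show "inv_into (fst c) (snd c) ` snd c ` (fst c \<inter> fst d) \<subseteq> fst d"
      using inj by auto
    show "Ck_on k (snd c ` (fst c \<inter> fst d)) (inv_into (fst c) (snd c))"
      using euclidean_atlas_smooth(2)[OF c] by (rule Ck_on_mono) auto
  qed
  then show ?thesis by (simp add: smooth_transition_eq Cr_on_infinity o_def)
qed

lemma smooth_manifold_euclidean:
  "smooth_manifold euclidean (euclidean_atlas :: ('b::euclidean_space, 'b) chart set)"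
  unfolding smooth_manifold_def
proof (intro conjI exI[of _ UNIV] ballI allI impI)
  show "second_countable_topology_on (euclidean :: 'b topology)"
  proof -
    obtain \<B> :: "'b set set" where "countable \<B>" "topological_basis \<B>"
      using ex_countable_basis by blast
    then show ?thesis
      unfolding second_countable_topology_on_def topological_basis_def open_openin[symmetric]
      by (metis (no_types, lifting))
  qed
  show "(\<Union>c\<in>(euclidean_atlas :: ('b, 'b) chart set). fst c) = topspace euclidean"
    by (simp add: Union_euclidean_atlas)
  show "c \<in> euclidean_atlas" if "is_chart euclidean UNIV c \<and> (\<forall>d\<in>euclidean_atlas. compatible c d)"
    for c :: "('b, 'b) chart"
    using that ident_in_euclidean_atlas by (auto simp: euclidean_atlas_def)
qed (auto simp: euclidean_atlas_chart compatible_def euclidean_transition)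

interpretation euclid: manifold_charts euclidean "euclidean_atlas :: ('b::euclidean_space, 'b) chart set"
proof
  show "(\<Union>c\<in>(euclidean_atlas :: ('b, 'b) chart set). fst c) = topspace euclidean"
    by (simp add: Union_euclidean_atlas)
qed (auto simp: euclidean_atlas_chart euclidean_transition)

lemma Cr_map_euclidean:
  fixes g :: "'b::euclidean_space \<Rightarrow> 'b"
  assumes g: "\<And>k. Ck_on k V g"
  shows "Cr_map euclidean euclidean_atlas r V g"
proof -
  have "Ck_on k (coord_dom V g c d) (coord_map g c d)"
    if c: "c \<in> euclidean_atlas" and d: "d \<in> euclidean_atlas" for c d and k
  proof -
    let ?\<psi> = "inv_into (fst c) (snd c)"
    have 1: "Ck_on k (coord_dom V g c d) ?\<psi>"
      by (rule Ck_on_mono[OF euclidean_atlas_smooth(2)[OF c]]) (auto simp: coord_dom_eq)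
    have 2: "Ck_on k (coord_dom V g c d) (\<lambda>x. g (?\<psi> x))"
      by (rule Ck_on_compose[OF _ 1 g]) (auto simp: coord_dom_eq euclid.chart_inv[OF c])
    have "Ck_on k (coord_dom V g c d) (\<lambda>x. snd d (g (?\<psi> x)))"
      by (rule Ck_on_compose[OF _ 2 euclidean_atlas_smooth(1)[OF d]]) (auto simp: coord_dom_eq euclid.chart_inv[OF c])
    then show ?thesis by (simp add: coord_map_eq o_def)
  qed
  then show ?thesis
    using Ck_on_continuous[OF g] by (auto simp: Cr_map_def Cr_on_def)
qed

lemma coord_dom_ident [simp]: "coord_dom V g (UNIV, \<lambda>x. x) (UNIV, \<lambda>x. x) = V"
  and coord_map_ident [simp]: "coord_map g (UNIV, \<lambda>x. x) (UNIV, \<lambda>x. x) = g"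
  by (auto simp: coord_dom_eq coord_map_eq)

section \<open>The level sets of a quartic\<close>

definition quartic :: "complex \<Rightarrow> real" where
  "quartic w = Re w ^ 4 + Im w ^ 4"

lemma quartic_nonneg: "0 \<le> quartic w"
  by (simp add: quartic_def)

lemma quartic_eq_0: "quartic w = 0 \<longleftrightarrow> w = 0"
  by (auto simp: quartic_def complex_eq_iff add_nonneg_eq_0_iff)

lemma quartic_pos: "w \<noteq> 0 \<Longrightarrow> 0 < quartic w"
  using quartic_nonneg[of w] quartic_eq_0[of w] by linarith

lemma quartic_scale: "quartic (of_real t * w) = t ^ 4 * quartic w"
  by (simp add: quartic_def power_mult_distrib algebra_simps)

lemma quartic_minus: "quartic (- w) = quartic w"
  by (simp add: quartic_def)

lemma quartic_ii: "quartic (\<i> * w) = quartic w"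
  by (simp add: quartic_def)

lemma Ck_on_power:
  fixes f :: "'a::real_normed_vector \<Rightarrow> real"
  assumes "Ck_on k D f" shows "Ck_on k D (\<lambda>x. f x ^ n)"
  by (induction n) (simp_all add: Ck_on_const Ck_on_mult assms)

lemma Ck_on_Re: "Ck_on k D Re" and Ck_on_Im: "Ck_on k D Im"
  by (simp_all add: Ck_on_bounded_linear bounded_linear_Re bounded_linear_Im)

lemma Ck_on_quartic: "Ck_on k D quartic"
  unfolding quartic_def[abs_def] by (intro Ck_on_add Ck_on_power Ck_on_Re Ck_on_Im)

lemma continuous_on_quartic: "continuous_on D quartic"
  using Ck_on_continuous[OF Ck_on_quartic] .

text \<open>The twist rotates along the level sets of the quartic: the radial factor restores the value
  of the quartic after a rotation by an angle that decreases from \<open>\<pi>\<close> to 0.\<close>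

definition turn :: "complex \<Rightarrow> complex" where
  "turn w = cis (pi * cutoff (quartic w))"

definition twist :: "complex \<Rightarrow> complex" where
  "twist w = w * turn w * of_real (quartic w powr (1/4) * quartic (w * turn w) powr - (1/4))"

lemma turn_nonzero: "w \<noteq> 0 \<Longrightarrow> w * turn w \<noteq> 0"
  by (simp add: turn_def)

text \<open>The quartic is homogeneous of degree 4, so a radial factor equal to the fourth root of
  \<open>?a / ?b\<close> changes the value \<open>?b\<close> after the rotation back to
  \<open>?a\<close>.\<close>

lemma quartic_twist: "quartic (twist w) = quartic w"
proof (cases "w = 0")
  case False
  let ?a = "quartic w" and ?b = "quartic (w * turn w)"
  have pos: "?a > 0" "?b > 0" using False turn_nonzero quartic_pos by auto
  have "quartic (twist w) = (?a powr (1/4) * ?b powr - (1/4)) ^ 4 * ?b"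
    unfolding twist_def by (subst mult.commute) (rule quartic_scale)
  also have "\<dots> = ?a"
    using pos by (simp add: power_mult_distrib powr_power powr_minus field_simps)
  finally show ?thesis .
qed (simp add: twist_def)

lemma twist_inner: "quartic w \<le> 1/4 \<Longrightarrow> twist w = - w"
  using quartic_pos[of w]
  by (cases "w = 0") (simp_all add: twist_def turn_def cutoff_eq_1 quartic_minus powr_minus)

lemma twist_outer: "3/4 \<le> quartic w \<Longrightarrow> twist w = w"
  by (simp add: twist_def turn_def cutoff_eq_0 powr_minus)

text \<open>The defining formula is of no use at 0, where the arguments of \<open>powr\<close>
  vanish; near 0 the twist is linear. Away from 0 both arguments are positive.\<close>

lemma Ck_on_twist: "Ck_on k UNIV twist"
proof (rule Ck_on_open_local)
  fix x :: complex
  show "\<exists>N. open N \<and> x \<in> N \<and> N \<subseteq> UNIV \<and> Ck_on k N twist"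
  proof (cases "x = 0")
    case True
    have "open {w. quartic w < 1/4}"
      by (intro open_Collect_less continuous_on_quartic continuous_on_const)
    moreover have "Ck_on k {w. quartic w < 1/4} twist"
      by (rule Ck_on_cong[OF Ck_on_bounded_linear[OF bounded_linear_minus[OF bounded_linear_ident]]])
         (simp add: twist_inner)
    ultimately show ?thesis using True by (intro exI[of _ "{w. quartic w < 1/4}"]) (simp add: quartic_def)
  next
    case False
    let ?N = "- {0::complex}"
    have "Ck_on k ?N (\<lambda>w. cutoff (quartic w))"
      by (rule Ck_on_compose[OF subset_UNIV Ck_on_quartic Ck_on_cutoff])
    then have "Ck_on k ?N (\<lambda>w. pi * cutoff (quartic w))"
      by (rule Ck_on_mult[OF Ck_on_const])
    then have t: "Ck_on k ?N turn"
      unfolding turn_def[abs_def] by (rule Ck_on_compose[OF subset_UNIV _ Ck_on_cis])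
    have wt: "Ck_on k ?N (\<lambda>w. w * turn w)"
      by (rule Ck_on_mult[OF Ck_on_bounded_linear[OF bounded_linear_ident] t])
    have q: "Ck_on k ?N (\<lambda>w. quartic (w * turn w))"
      by (rule Ck_on_compose[OF subset_UNIV wt Ck_on_quartic])
    have 1: "Ck_on k ?N (\<lambda>w. quartic w powr (1/4))"
      by (rule Ck_on_compose[OF _ Ck_on_quartic Ck_on_powr]) (use quartic_pos in auto)
    have 2: "Ck_on k ?N (\<lambda>w. quartic (w * turn w) powr - (1/4))"
      by (rule Ck_on_compose[OF _ q Ck_on_powr]) (use quartic_pos[OF turn_nonzero] in auto)
    have "Ck_on k ?N twist"
      unfolding twist_def[abs_def]
      by (rule Ck_on_mult[OF wt Ck_on_bounded_linear_comp[OF bounded_linear_of_real Ck_on_mult[OF 1 2]]])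
    then show ?thesis using False by (intro exI[of _ ?N]) auto
  qed
qed

section \<open>The partition into level sets and the disc as a submanifold\<close>

definition levels :: "complex set set" where
  "levels = range (\<lambda>w. {v. quartic v = quartic w})"

definition disc :: "complex set" where
  "disc = {w. quartic w \<le> 1}"

lemma level_iff: "\<omega> \<in> levels \<Longrightarrow> w \<in> \<omega> \<Longrightarrow> v \<in> \<omega> \<longleftrightarrow> quartic v = quartic w"
  by (auto simp: levels_def)

lemma zero_level: "{0} \<in> levels"
proof -
  have q0: "quartic 0 = 0" by (simp add: quartic_def)
  have "{0} = {v. quartic v = quartic 0}" unfolding q0 quartic_eq_0 by simp
  then show ?thesis unfolding levels_def by blast
qed

lemma singular_partition_levels: "singular_partition euclidean levels {{0}}"
  unfolding singular_partition_def
proof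
  show "partition_on (topspace euclidean) levels"
    unfolding partition_on_def
  proof (intro conjI)
    show "disjoint levels" by (auto simp: levels_def disjoint_def)
  qed (auto simp: levels_def)
qed (simp add: zero_level)

lemma closed_disc: "closed disc"
  unfolding disc_def by (intro closed_Collect_le continuous_on_quartic continuous_on_const)

text \<open>Compactness serves twice: the whole disc is the fibre over 0 of the final collapse,
  which must be proper, and it makes the images of the dilations closed.\<close>

lemma compact_disc: "compact disc"
proof -
  have abs_le: "\<bar>x\<bar> \<le> 1" if "x ^ 4 \<le> 1" for x :: real
  proof -
    have "\<not> 1 < \<bar>x\<bar>" using one_less_power[of "\<bar>x\<bar>" 4] that by (auto simp: power_even_abs)
    then show ?thesis by simp
  qed
  have "norm w \<le> 2" if "w \<in> disc" for w
  proof -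
    have "Re w ^ 4 \<le> 1" "Im w ^ 4 \<le> 1"
    proof -
      have "0 \<le> Re w ^ 4" "0 \<le> Im w ^ 4" by simp_all
      then show "Re w ^ 4 \<le> 1" "Im w ^ 4 \<le> 1"
        using that unfolding disc_def quartic_def mem_Collect_eq by linarith+
    qed
    then have "\<bar>Re w\<bar> \<le> 1" "\<bar>Im w\<bar> \<le> 1" using abs_le by blast+
    then show ?thesis using cmod_le[of w] by linarith
  qed
  then show ?thesis using closed_disc by (auto simp: compact_eq_bounded_closed bounded_iff)
qed

lemma open_quartic_less: "open {w. quartic w < c}"
  by (intro open_Collect_less continuous_on_quartic continuous_on_const)

lemma interior_disc: "quartic w < 1 \<Longrightarrow> w \<in> interior disc"
  by (rule interiorI[OF open_quartic_less[of 1]]) (auto simp: disc_def)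

text \<open>Near a boundary point with positive imaginary part, \<open>z \<mapsto> (Re z, 1 - quartic z)\<close> straightens
  the boundary; rotating by multiples of a right angle covers the remaining boundary points.\<close>

definition straighten :: "complex \<Rightarrow> complex \<Rightarrow> complex" where
  "straighten u w = Complex (Re (u * w)) (1 - quartic (u * w))"

lemma straighten_chart:
  assumes u: "u \<noteq> 0"
  shows "({w. 0 < Im (u * w)}, straighten u) \<in> euclidean_atlas"
proof (rule euclidean_atlasI)
  \<comment> \<open>With \<open>z = u * w\<close>, the equation
    \<open>Im q = 1 - Re z ^ 4 - Im z ^ 4\<close> and \<open>Re q = Re z\<close> are solved for the
    positive value \<open>Im z\<close> by a fourth root, possible below the curve
    \<open>Im q = 1 - Re q ^ 4\<close>.\<close>
  let ?\<psi> = "\<lambda>q. (of_real (Re q) + \<i> * of_real ((1 - Im q - Re q ^ 4) powr (1/4))) / u"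
  have Complex_eq': "Complex a b = of_real a + \<i> * of_real b" for a b by (simp add: complex_eq_iff)
  have root: "(Im z ^ 4) powr (1/4) = Im z" if "0 < Im z" for z
    unfolding powr_realpow[OF that, symmetric] powr_powr using that by simp
  have im: "straighten u ` {w. 0 < Im (u * w)} = {q. Im q < 1 - Re q ^ 4}"
  proof (intro set_eqI iffI)
    fix q assume "q \<in> {q. Im q < 1 - Re q ^ 4}"
    then have pos: "0 < 1 - Im q - Re q ^ 4" by simp
    then have "((1 - Im q - Re q ^ 4) powr (1/4)) ^ 4 = 1 - Im q - Re q ^ 4"
      by (simp add: powr_power)
    then have "straighten u (?\<psi> q) = q"
      using u by (simp add: straighten_def quartic_def complex_eq_iff)
    moreover have "0 < Im (u * ?\<psi> q)" using u pos by simp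
    ultimately show "q \<in> straighten u ` {w. 0 < Im (u * w)}" by (metis (mono_tags, lifting) image_eqI mem_Collect_eq)
  qed (auto simp: straighten_def quartic_def)
  show "open {w. 0 < Im (u * w)}" by (intro open_Collect_less continuous_intros)
  show "open (straighten u ` {w. 0 < Im (u * w)})"
    unfolding im by (intro open_Collect_less continuous_intros)
  show "?\<psi> (straighten u w) = w" if "w \<in> {w. 0 < Im (u * w)}" for w
  proof -
    have "1 - (1 - quartic (u * w)) - Re (u * w) ^ 4 = Im (u * w) ^ 4" by (simp add: quartic_def)
    moreover have "of_real (Re (u * w)) + \<i> * of_real (Im (u * w)) = u * w" by (simp add: complex_eq_iff)
    ultimately show ?thesis using root[of "u * w"] that u unfolding straighten_def by simp
  qed
  have lin: "Ck_on k D (\<lambda>w. u * w)" for k D by (rule Ck_on_bounded_linear) (rule bounded_linear_mult_right)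
  have q: "Ck_on k D (\<lambda>w. quartic (u * w))" for k D by (rule Ck_on_compose[OF subset_UNIV lin Ck_on_quartic])
  have r: "Ck_on k D (\<lambda>w. Re (u * w))" for k D by (rule Ck_on_compose[OF subset_UNIV lin Ck_on_Re])
  have "Ck_on k D (\<lambda>w. of_real (Re (u * w)) + \<i> * of_real (1 + - quartic (u * w)))" for k D
    by (intro Ck_on_add Ck_on_bounded_linear_comp[OF bounded_linear_of_real r]
        Ck_on_mult[OF Ck_on_const Ck_on_bounded_linear_comp[OF bounded_linear_of_real Ck_on_add[OF Ck_on_const Ck_on_minus[OF q]]]])
  then show "Ck_on k {w. 0 < Im (u * w)} (straighten u)" for k
    by (simp add: straighten_def[abs_def] Complex_eq')
  show "Ck_on k (straighten u ` {w. 0 < Im (u * w)}) ?\<psi>" for k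
    unfolding im
  proof -
    let ?D = "{q. Im q < 1 - Re q ^ 4}"
    have "Ck_on k ?D (\<lambda>q. 1 + - Im q + - (Re q ^ 4))"
      by (intro Ck_on_add Ck_on_const Ck_on_minus[where f=Im] Ck_on_minus[where f="\<lambda>q. Re q ^ 4"] Ck_on_power Ck_on_Re Ck_on_Im)
    then have 0: "Ck_on k ?D (\<lambda>q. 1 - Im q - Re q ^ 4)" by simp
    have 1: "Ck_on k ?D (\<lambda>q. (1 - Im q - Re q ^ 4) powr (1/4))"
      by (rule Ck_on_compose[OF _ 0 Ck_on_powr]) auto
    have "Ck_on k ?D (\<lambda>q. (of_real (Re q) + \<i> * of_real ((1 - Im q - Re q ^ 4) powr (1/4))) * inverse u)"
      by (rule Ck_on_mult[OF Ck_on_add[OF Ck_on_bounded_linear_comp[OF bounded_linear_of_real Ck_on_Re]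
            Ck_on_mult[OF Ck_on_const Ck_on_bounded_linear_comp[OF bounded_linear_of_real 1]]] Ck_on_const])
    then show "Ck_on k ?D ?\<psi>" unfolding divide_inverse .
  qed
qed

lemma submanifold_disc: "submanifold euclidean_atlas disc"
  unfolding submanifold_def
proof
  fix p assume p: "p \<in> disc"
  show "\<exists>(U, \<phi>)\<in>euclidean_atlas. p \<in> U \<and>
        (\<exists>S e. subspace S \<and> \<phi> ` (U \<inter> disc) = \<phi> ` U \<inter> {x \<in> S. 0 \<le> e \<bullet> x})"
  proof (cases "quartic p < 1")
    case True
    show ?thesis
    proof (rule bexI[of _ "({w. quartic w < 1}, \<lambda>x. x)"])
      show "({w. quartic w < 1}, \<lambda>x. x) \<in> euclidean_atlas" by (rule open_in_euclidean_atlas[OF open_quartic_less])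
      show "case ({w. quartic w < 1}, \<lambda>x. x) of (U, \<phi>) \<Rightarrow> p \<in> U \<and>
        (\<exists>S e. subspace S \<and> \<phi> ` (U \<inter> disc) = \<phi> ` U \<inter> {x \<in> S. 0 \<le> e \<bullet> x})"
        using True by (auto simp: disc_def intro!: exI[of _ "UNIV :: complex set"] exI[of _ "0 :: complex"])
    qed
  next
    case False
    then have "p \<noteq> 0" by (auto simp: quartic_def)
    then have "Re p \<noteq> 0 \<or> Im p \<noteq> 0" by (auto simp: complex_eq_iff)
    then have "\<exists>u\<in>{1, -1, \<i>, -\<i>}. 0 < Im (u * p)"
      by (auto simp: neq_iff)
    then obtain u where u: "u \<in> {1, -1, \<i>, -\<i>}" "0 < Im (u * p)" by blast
    then have "u \<noteq> 0" by auto
    have q: "quartic (u * w) = quartic w" for w using u by (auto simp: quartic_ii quartic_minus)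
    let ?U = "{w. 0 < Im (u * w)}"
    \<comment> \<open>The inner product with \<open>\<i>\<close> is the imaginary part, here
      \<open>1 - quartic (u * w)\<close>, so the half-space condition is the inequality defining
      \<open>disc\<close>.\<close>
    have "straighten u ` (?U \<inter> disc) = straighten u ` ?U \<inter> {x \<in> UNIV. 0 \<le> \<i> \<bullet> x}"
      using q by (auto simp: disc_def straighten_def inner_complex_def)
    then show ?thesis
      using straighten_chart[OF \<open>u \<noteq> 0\<close>] u(2)
      by (intro bexI[of _ "(?U, straighten u)"]) (auto intro!: exI[of _ "UNIV :: complex set"] exI[of _ \<i>])
  qed
qed

section \<open>Dilations as an invariant contraction\<close>

lemma Ck_on_of_real_mult: "Ck_on k D (\<lambda>w. of_real t * w :: complex)"
  by (rule Ck_on_bounded_linear) (rule bounded_linear_mult_right)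

lemma scaled_in_disc: "w \<in> disc \<Longrightarrow> t \<in> {0..1} \<Longrightarrow> of_real t * w \<in> disc"
  using mult_le_one[of "t ^ 4" "quartic w"] quartic_nonneg[of w]
  by (simp add: disc_def quartic_scale power_le_one)

lemma scaling_closed_embedding:
  assumes t: "t \<in> {0<..1}"
  shows "closed_Cr_embedding euclidean euclidean_atlas \<infinity> disc (\<lambda>w. of_real t * w)"
  unfolding closed_Cr_embedding_def
proof (intro conjI impI ballI)
  let ?g = "\<lambda>w::complex. of_real t * w"
  show sub: "?g ` disc \<subseteq> disc" using scaled_in_disc[of _ t] t by auto
  show "Cr_map euclidean euclidean_atlas \<infinity> disc ?g"
    by (rule Cr_map_euclidean[OF Ck_on_of_real_mult])
  have cont: "continuous_on D ?g" for D by (intro continuous_intros)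
  have "homeomorphic_maps (top_of_set disc) (top_of_set (?g ` disc)) ?g (\<lambda>w. w / of_real t)"
    using t by (auto simp: homeomorphic_maps_def continuous_map_in_subtopology cont intro!: continuous_intros)
  then have "homeomorphic_map (top_of_set disc) (top_of_set (?g ` disc)) ?g"
    unfolding homeomorphic_map_maps by blast
  then show "embedding_map (top_of_set disc) (top_of_set disc) ?g"
    using sub by (auto simp: embedding_map_def subtopology_subtopology Int_absorb1)
  have "closed (?g ` disc)"
    by (intro compact_imp_closed compact_continuous_image cont compact_disc)
  then show "closedin (top_of_set disc) (?g ` disc)"
    using sub by (intro closed_subset)
  fix z assume z: "z \<in> disc"
  have "(?g has_derivative ?g) (at z within disc)"
    by (intro bounded_linear_imp_has_derivative bounded_linear_mult_right)
  then have "tangent_map euclidean_atlas disc ?g z ?g"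
    unfolding tangent_map_def using ident_in_euclidean_atlas
    by (intro bexI[of _ "(UNIV, \<lambda>x. x)"]) auto
  moreover have "inj ?g" using t by (auto intro!: injI)
  ultimately show "\<exists>D. tangent_map euclidean_atlas disc ?g z D \<and> inj D" by blast
qed

lemma scaled_level:
  assumes t: "t \<in> {0<..1}" and \<omega>: "\<omega> \<in> levels"
  shows "(\<lambda>w. of_real t * w) ` \<omega> \<in> levels"
proof -
  obtain w where w: "\<omega> = {v. quartic v = quartic w}" using \<omega> by (auto simp: levels_def)
  have "(\<lambda>w. of_real t * w) ` \<omega> = {v. quartic v = quartic (of_real t * w)}"
  proof (intro set_eqI iffI)
    fix v assume "v \<in> {v. quartic v = quartic (of_real t * w)}"
    moreover have "v = of_real t * (v / of_real t)" using t by simp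
    moreover then have "quartic v = t ^ 4 * quartic (v / of_real t)" by (metis quartic_scale)
    ultimately have "v / of_real t \<in> \<omega>" using t by (simp add: w quartic_scale)
    then show "v \<in> (\<lambda>w. of_real t * w) ` \<omega>" using \<open>v = of_real t * (v / of_real t)\<close> by blast
  qed (auto simp: w quartic_scale)
  then show ?thesis by (auto simp: levels_def)
qed

lemma invariant_disc: "invariant_set euclidean levels disc"
  unfolding invariant_set_def
proof (intro conjI ballI impI)
  fix \<omega> assume "\<omega> \<in> levels" "\<omega> \<inter> disc \<noteq> {}"
  then show "\<omega> \<subseteq> disc" by (auto simp: levels_def disc_def)
qed simp

lemma zero_in_interior_disc: "0 \<in> interior disc"
  by (rule interior_disc) (simp add: quartic_def)

text \<open>Multiplication by \<open>t > 0\<close> scales the quartic by \<open>t ^ 4\<close> and so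
  carries levels onto levels, with \<open>{0}\<close> the only one sent to \<open>{0}\<close>. At
  time 0 everything collapses to the origin, and the single fibre is the invariant set
  \<open>disc\<close>.\<close>

lemma invariant_contraction_disc:
  "invariant_contraction euclidean euclidean_atlas levels {{0}} \<infinity> {0} disc"
  unfolding invariant_contraction_def
proof (intro conjI exI[of _ "\<lambda>t w. of_real t * w"] ballI allI impI)
  have zero: "0 \<in> disc" using zero_in_interior_disc interior_subset by blast
  show "closedin euclidean disc" using closed_disc by simp
  show "invariant_set euclidean levels disc" by (rule invariant_disc)
  show "{0} \<subseteq> euclidean interior_of disc" using zero_in_interior_disc by simp
  show "submanifold euclidean_atlas disc" by (rule submanifold_disc)
  show "continuous_map (prod_topology (top_of_set disc) (top_of_set {0..1})) (top_of_set disc)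
          (\<lambda>(x, t). complex_of_real t * x)"
    using scaled_in_disc by (auto simp: continuous_map_in_subtopology case_prod_unfold intro!: continuous_intros)
  show "(\<lambda>w. complex_of_real 0 * w) ` disc = {0}" using zero by auto
  show "compactin euclidean {x \<in> disc. complex_of_real 0 * x \<in> K}" if "K \<subseteq> {0}" "compactin euclidean K" for K
    by (cases "0 \<in> K") (simp_all add: compact_disc)
  show "closed_Cr_embedding euclidean euclidean_atlas \<infinity> disc (\<lambda>w. complex_of_real t * w)" if "t \<in> {0<..1}" for t
    by (rule scaling_closed_embedding[OF that])
  show "(\<lambda>w. complex_of_real t * w) ` \<omega> \<in> levels - {{0}}"
    if t: "t \<in> {0<..1}" and \<omega>: "\<omega> \<in> levels - {{0}}" "\<omega> \<subseteq> disc" for t \<omega>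
  proof -
    have "\<omega> = {0}" if im: "(\<lambda>w. complex_of_real t * w) ` \<omega> = {0}"
    proof -
      have "w = 0" if "w \<in> \<omega>" for w
      proof -
        have "complex_of_real t * w \<in> {0}" using that im by blast
        then show ?thesis using t by simp
      qed
      moreover have "\<omega> \<noteq> {}" using im by auto
      ultimately show ?thesis by blast
    qed
    then show ?thesis using scaled_level[OF t, of \<omega>] \<omega> by auto
  qed
  show "(\<lambda>w. complex_of_real t * w) ` \<omega> \<in> {{0}}" if "\<omega> \<in> {{0}}" for t \<omega>
    using that by simp
  show "invariant_set euclidean levels {x \<in> disc. complex_of_real 0 * x = z}" if "z \<in> {0}" for z
    using that invariant_disc by simp
  show "(\<lambda>w. complex_of_real t * w) ` {x \<in> disc. complex_of_real 0 * x = z} \<subseteq> {x \<in> disc. complex_of_real 0 * x = z}"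
    if "z \<in> {0}" "t \<in> {0..1}" for z t
    using that scaled_in_disc by auto
qed auto

text \<open>The origin is the only singular point, and near it the twist is the half turn, its own
  inverse.\<close>

lemma twist_in_\<E>: "restrict twist disc \<in> \<E> euclidean euclidean_atlas levels {{0}} disc"
proof -
  let ?h = "restrict twist disc"
  have smooth: "Cr_map euclidean euclidean_atlas \<infinity> W twist" for W
    by (rule Cr_map_euclidean[OF Ck_on_mono[OF Ck_on_twist]]) simp
  have h: "Cr_map euclidean euclidean_atlas \<infinity> disc ?h"
    by (rule euclid.Cr_map_cong[OF smooth]) simp
  have "local_diffeo_at euclidean euclidean_atlas disc ?h 0"
  proof -
    let ?N = "{w. quartic w < 1/4}"
    have N: "open ?N" "0 \<in> ?N" by (rule open_quartic_less) (simp add: quartic_def)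
    have Nd: "?N \<subseteq> disc" by (auto simp: disc_def)
    have eq: "?h w = - w" if "w \<in> ?N" for w using that Nd twist_inner by auto
    have im: "?h ` ?N = ?N"
    proof
      show "?h ` ?N \<subseteq> ?N" using eq quartic_minus by auto
      show "?N \<subseteq> ?h ` ?N"
      proof
        fix w assume "w \<in> ?N"
        then have "- w \<in> ?N" by (simp add: quartic_minus)
        moreover then have "?h (- w) = w" using eq[of "- w"] by simp
        ultimately show "w \<in> ?h ` ?N" by (metis imageI)
      qed
    qed
    have inj: "inj_on ?h ?N" using eq by (intro inj_onI) (metis minus_equation_iff)
    have "Cr_map euclidean euclidean_atlas \<infinity> ?N (\<lambda>w. - w)"
      by (intro Cr_map_euclidean Ck_on_bounded_linear bounded_linear_minus bounded_linear_ident)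
    then have "Cr_map euclidean euclidean_atlas \<infinity> ?N (inv_into ?N ?h)"
    proof (rule euclid.Cr_map_cong)
      fix w assume "w \<in> ?N"
      then have "- w \<in> ?N" by (simp add: quartic_minus)
      then show "- w = inv_into ?N ?h w" using inv_into_f_f[OF inj, of "- w"] eq[of "- w"] by simp
    qed
    then show ?thesis
      using N Nd im inj zero_in_interior_disc euclid.Cr_map_subset[OF h Nd]
      by (auto simp: local_diffeo_at_def intro!: exI[of _ ?N])
  qed
  then show ?thesis
    using h level_iff quartic_twist by (auto simp: \<E>_def Cr_maps_def)
qed

lemma twist_fixed_outside: "fixed_outside_nbhd euclidean {0} disc (restrict twist disc)"
  unfolding fixed_outside_nbhd_def
\<comment> \<open>The cutoff vanishes from \<open>3/4\<close> on, so the twist is the identity off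
  this set; as \<open>3/4 < 1\<close>, the set is closed inside the interior of the disc.\<close>
proof (intro exI[of _ "{w. quartic w \<le> 3/4}"] conjI ballI)
  have "0 \<in> interior {w. quartic w \<le> 3/4}"
    by (rule interiorI[OF open_quartic_less[of "3/4"]]) (auto simp: quartic_def)
  then show "{0} \<subseteq> euclidean interior_of {w. quartic w \<le> 3/4}" by simp
  have "closed {w. quartic w \<le> 3/4}"
    by (intro closed_Collect_le continuous_on_quartic continuous_on_const)
  then have "closure {w. quartic w \<le> 3/4} = {w. quartic w \<le> 3/4}" by simp
  then show "euclidean closure_of {w. quartic w \<le> 3/4} \<subseteq> euclidean interior_of disc"
    using interior_disc by auto
qed (auto simp: twist_outer)

section \<open>Rigidity of the tangent map at the origin\<close>

text \<open>Adding the values at \<open>(1, 1)\<close> and \<open>(1, -1)\<close> isolates the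
  coefficient of \<open>x\<^sup>2 * y\<^sup>2\<close>, which must vanish:
  \<open>(a * b)\<^sup>2 + (c * d)\<^sup>2 = 0\<close>. If \<open>a\<close> is nonzero, then
  \<open>b = 0\<close>, hence \<open>d\<close> is nonzero, \<open>c = 0\<close> and
  \<open>a ^ 4 = 1\<close>.\<close>

lemma quartic_symmetry:
  fixes a b c d :: real
  assumes "\<And>x y. (x * a + y * b) ^ 4 + (x * c + y * d) ^ 4 = x ^ 4 + y ^ 4"
  shows "a = 0 \<or> a ^ 4 = 1"
proof -
  have e: "a ^ 4 + c ^ 4 = 1" "b ^ 4 + d ^ 4 = 1" "(a + b) ^ 4 + (c + d) ^ 4 = 2" "(a - b) ^ 4 + (c - d) ^ 4 = 2"
    using assms[of 1 0] assms[of 0 1] assms[of 1 1] assms[of 1 "-1"] by simp_all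
  have "(a + b) ^ 4 + (a - b) ^ 4 = 2 * a ^ 4 + 12 * (a * b)\<^sup>2 + 2 * b ^ 4"
    "(c + d) ^ 4 + (c - d) ^ 4 = 2 * c ^ 4 + 12 * (c * d)\<^sup>2 + 2 * d ^ 4"
    by algebra+
  then have "(a * b)\<^sup>2 + (c * d)\<^sup>2 = 0" using e by linarith
  then have "a * b = 0" "c * d = 0" by (simp_all add: add_nonneg_eq_0_iff)
  then show ?thesis using e(1,2) by auto
qed

text \<open>By homogeneity the quotient \<open>g (s * w) / s\<close> has the same quartic as
  \<open>w\<close> for all small nonzero real \<open>s\<close>. Its limit \<open>D w\<close>
  inherits this, so the tangent map is a linear symmetry of the quartic.\<close>

lemma derivative_at_zero:
  assumes "g \<in> \<E> euclidean euclidean_atlas levels {{0}} disc"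
  obtains D where "(g has_derivative D) (at 0)" "Re (D 1) = 0 \<or> Re (D 1) ^ 4 = 1"
proof -
  have "Cr_map euclidean euclidean_atlas \<infinity> disc g" using assms by (simp add: \<E>_def Cr_maps_def)
  then have "Cr_on \<infinity> disc g"
    using ident_in_euclidean_atlas unfolding Cr_map_def by (metis coord_dom_ident coord_map_ident)
  then have "Ck_on (Suc 0) disc g" unfolding Cr_on_infinity by blast
  moreover have "0 \<in> disc" using zero_in_interior_disc interior_subset by blast
  ultimately obtain D where "(g has_derivative D) (at 0 within disc)" unfolding Ck_on.simps by blast
  then have D: "(g has_derivative D) (at 0)"
    using at_within_interior[OF zero_in_interior_disc] by simp
  have pres: "quartic (g w) = quartic w" if "w \<in> disc" for w
    using assms that by (auto simp: \<E>_def levels_def)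
  have g0: "g 0 = 0" using pres[OF \<open>0 \<in> disc\<close>] quartic_eq_0 by (metis)
  have linD: "linear D" using D has_derivative_linear by blast
  have quarticD: "quartic (D w) = quartic w" for w
  proof -
    have "((\<lambda>s. of_real s * w) has_derivative (\<lambda>s. of_real s * w)) (at 0)"
      by (intro bounded_linear_imp_has_derivative bounded_linear_mult_const bounded_linear_of_real)
    from has_derivative_compose[OF this, of g D] D
    have gD: "((\<lambda>s. g (of_real s * w)) has_derivative (\<lambda>s. D (of_real s * w))) (at 0)" by simp
    have Ds: "D (of_real s * w) = s *\<^sub>R D w" for s
      using linear_cmul[OF linD, of s w] by (simp add: scaleR_conv_of_real)
    have "DERIV (\<lambda>s. Re (g (of_real s * w))) 0 :> Re (D w)" "DERIV (\<lambda>s. Im (g (of_real s * w))) 0 :> Im (D w)"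
      using bounded_linear.has_derivative[OF bounded_linear_Re gD] bounded_linear.has_derivative[OF bounded_linear_Im gD]
      by (simp_all add: has_field_derivative_def Ds mult.commute[of _ "Re (D w)"] mult.commute[of _ "Im (D w)"])
    then have "((\<lambda>s. Re (g (of_real s * w)) / s) \<longlongrightarrow> Re (D w)) (at 0)" "((\<lambda>s. Im (g (of_real s * w)) / s) \<longlongrightarrow> Im (D w)) (at 0)"
      by (simp_all add: DERIV_def g0)
    then have "((\<lambda>s. (Re (g (of_real s * w)) / s) ^ 4 + (Im (g (of_real s * w)) / s) ^ 4) \<longlongrightarrow> quartic (D w)) (at 0)"
      unfolding quartic_def by (intro tendsto_add tendsto_power)
    moreover have "eventually (\<lambda>s. (Re (g (of_real s * w)) / s) ^ 4 + (Im (g (of_real s * w)) / s) ^ 4 = quartic w) (at 0)"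
    proof -
      have "((\<lambda>s. of_real s * w) \<longlongrightarrow> 0) (at (0::real))"
        by (auto intro!: tendsto_eq_intros)
      then have "eventually (\<lambda>s. of_real s * w \<in> interior disc) (at (0::real))"
        using zero_in_interior_disc by (intro topological_tendstoD) auto
      then show ?thesis
      proof (rule eventually_mp[rotated], intro eventually_at_filter[THEN iffD2] always_eventually allI impI)
        fix s :: real assume s: "s \<noteq> 0" "of_real s * w \<in> interior disc"
        then have "quartic (g (of_real s * w)) = s ^ 4 * quartic w"
          using pres interior_subset quartic_scale by (metis subsetD)
        then show "(Re (g (of_real s * w)) / s) ^ 4 + (Im (g (of_real s * w)) / s) ^ 4 = quartic w"
          using s by (simp add: quartic_def power_divide field_simps)
      qed
    qed
    ultimately have "((\<lambda>s. quartic w) \<longlongrightarrow> quartic (D w)) (at (0::real))"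
      by (rule Lim_transform_eventually)
    then show ?thesis by (simp add: tendsto_const_iff)
  qed
  have "(x * Re (D 1) + y * Re (D \<i>)) ^ 4 + (x * Im (D 1) + y * Im (D \<i>)) ^ 4 = x ^ 4 + y ^ 4" for x y
  proof -
    have "D (Complex x y) = D (x *\<^sub>R 1 + y *\<^sub>R \<i>)" by (rule arg_cong[of _ _ D]) (simp add: complex_eq_iff)
    also have "\<dots> = x *\<^sub>R D 1 + y *\<^sub>R D \<i>" by (simp add: linear_add[OF linD] linear_cmul[OF linD])
    finally show ?thesis using quarticD[of "Complex x y"] by (simp add: quartic_def)
  qed
  then have "Re (D 1) = 0 \<or> Re (D 1) ^ 4 = 1" by (rule quartic_symmetry)
  with D show ?thesis using that by blast
qed

text \<open>Along a path in the \<open>C\<^sup>1\<close> topology the first entry of the tangent map at 0 varies continuously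
  in the discrete set \<open>{-1, 0, 1}\<close>, hence is constant. It equals 1 for the identity and -1 for
  the twist.\<close>

lemma twist_notin_\<E>_id: "restrict twist disc \<notin> \<E>_id euclidean euclidean_atlas levels {{0}} disc 1"
proof
  let ?E = "\<E> euclidean euclidean_atlas levels {{0}} disc"
  let ?W = "weak_Whitney_topology euclidean euclidean_atlas 1 disc"
  let ?c = "(UNIV, \<lambda>x. x) :: (complex, complex) chart"
  assume "restrict twist disc \<in> \<E>_id euclidean euclidean_atlas levels {{0}} disc 1"
  then obtain \<gamma> where path: "pathin (subtopology ?W ?E) \<gamma>" and \<gamma>0: "\<gamma> 0 = (\<lambda>x\<in>disc. x)" and \<gamma>1: "\<gamma> 1 = restrict twist disc"
    by (auto simp: \<E>_id_def path_component_of_def)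
  have cont: "continuous_map (top_of_set {0..1}) ?W \<gamma>" and \<gamma>E: "\<And>t. t \<in> {0..1} \<Longrightarrow> \<gamma> t \<in> ?E"
    using path by (auto simp: pathin_def continuous_map_in_subtopology)
  have zero: "0 \<in> disc" using zero_in_interior_disc interior_subset by blast
  \<comment> \<open>The direction 1 belongs to \<open>Basis\<close>, so the list \<open>[1]\<close>
    is among those controlled by a \<open>C\<^sup>1\<close> neighbourhood.\<close>
  define a where "a t = Re (partial_deriv [1] disc (\<gamma> t) 0)" for t
  have a_eq: "a t = Re (D 1)" if "(\<gamma> t has_derivative D) (at 0)" for t D
    using frechet_derivative_at[OF that] at_within_interior[OF zero_in_interior_disc] by (simp add: a_def)
  have "continuous_on {0..1} a"
    unfolding continuous_on_iff
  proof (intro ballI allI impI)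
    fix t0 \<epsilon> :: real assume t0: "t0 \<in> {0..1}" and \<epsilon>: "0 < \<epsilon>"
    have \<gamma>C: "\<gamma> t \<in> Cr_maps euclidean euclidean_atlas 1 disc" if "t \<in> {0..1}" for t
      using \<gamma>E[OF that] by (auto simp: \<E>_def Cr_maps_def Cr_map_def Cr_on_def)
    \<comment> \<open>The origin alone suffices as compact set, and with identity charts at both
      ends every coordinate domain is \<open>disc\<close>.\<close>
    let ?N = "Whitney_nbhd euclidean euclidean_atlas 1 disc (\<gamma> t0) ?c ?c {0} 1 \<epsilon>"
    have "openin ?W ?N"
      unfolding weak_Whitney_topology_def
    proof (rule topology_generated_by_Basis, rule insertI2, intro CollectI exI conjI)
      show "?N = ?N" ..
    qed (use \<gamma>C[OF t0] ident_in_euclidean_atlas zero \<epsilon> in \<open>auto simp: one_enat_def\<close>)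
    then have "openin (top_of_set {0..1}) {t \<in> {0..1}. \<gamma> t \<in> ?N}"
      using openin_continuous_map_preimage[OF cont] by simp
    moreover have "t0 \<in> {t \<in> {0..1}. \<gamma> t \<in> ?N}"
      using t0 \<gamma>C[OF t0] \<epsilon> by (auto simp: Whitney_nbhd_def)
    ultimately obtain \<delta> where \<delta>: "\<delta> > 0" "\<And>t. t \<in> {0..1} \<Longrightarrow> dist t t0 < \<delta> \<Longrightarrow> \<gamma> t \<in> ?N"
      by (auto simp: openin_euclidean_subtopology_iff)
    have "dist (a t) (a t0) < \<epsilon>" if "t \<in> {0..1}" "dist t t0 < \<delta>" for t
    proof -
      have "\<forall>vs. set vs \<subseteq> Basis \<and> length vs \<le> 1 \<longrightarrow>
          norm (partial_deriv vs disc (\<gamma> t0) 0 - partial_deriv vs disc (\<gamma> t) 0) < \<epsilon>"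
        using \<delta>(2)[OF that] by (simp add: Whitney_nbhd_def)
      from this[rule_format, of "[1]"]
      have n: "norm (partial_deriv [1] disc (\<gamma> t0) 0 - partial_deriv [1] disc (\<gamma> t) 0) < \<epsilon>"
        by (simp add: Basis_complex_def)
      show ?thesis
        using abs_Re_le_cmod[of "partial_deriv [1] disc (\<gamma> t0) 0 - partial_deriv [1] disc (\<gamma> t) 0"] n
        by (simp add: a_def dist_real_def abs_minus_commute)
    qed
    with \<delta>(1) show "\<exists>\<delta>>0. \<forall>t\<in>{0..1}. dist t t0 < \<delta> \<longrightarrow> dist (a t) (a t0) < \<epsilon>" by blast
  qed
  moreover have "a 0 = 1"
  proof -
    have "((\<lambda>x\<in>disc. x) has_derivative (\<lambda>x. x)) (at 0)"
      by (rule has_derivative_transform_within_open[OF has_derivative_ident open_interior zero_in_interior_disc])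
         (use interior_subset[of disc] in auto)
    then show ?thesis using a_eq[of 0] by (simp add: \<gamma>0)
  qed
  moreover have "a 1 = - 1"
  proof -
    have "(restrict twist disc has_derivative uminus) (at 0)"
    proof (rule has_derivative_transform_within_open[OF _ open_quartic_less[of "1/4"]])
      show "(uminus has_derivative uminus) (at (0::complex))"
        by (intro bounded_linear_imp_has_derivative bounded_linear_minus bounded_linear_ident)
      show "(0::complex) \<in> {w. quartic w < 1/4}" by (simp add: quartic_def)
    qed (auto simp: disc_def twist_inner)
    then show ?thesis using a_eq[of 1] by (simp add: \<gamma>1)
  qed
  \<comment> \<open>The function \<open>a\<close> falls from 1 to -1, so it attains
    \<open>1/2\<close>, which is neither 0 nor a real number with fourth power 1.\<close>
  ultimately obtain t where t: "t \<in> {0..1}" "a t = 1/2"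
    using IVT2'[of a 1 "1/2" 0] by auto
  obtain D where D: "(\<gamma> t has_derivative D) (at 0)" "Re (D 1) = 0 \<or> Re (D 1) ^ 4 = 1"
    using derivative_at_zero[OF \<gamma>E[OF t(1)]] .
  then have "Re (D 1) = 1/2" using a_eq[OF D(1)] t(2) by simp
  with D(2) show False by (simp add: power_divide)
qed

theorem theorem4p7:
  shows
    "(\<forall>(M :: 'a topology) (A :: ('a, 'b::euclidean_space) chart set) \<P> \<Sigma> Z V h.
        smooth_manifold M A \<and> singular_partition M \<P> \<Sigma> \<and>
        closedin M Z \<and> (\<forall>z\<in>Z. {z} \<in> \<Sigma>) \<and>
        invariant_contraction M A \<P> \<Sigma> \<infinity> Z V \<and>
        h \<in> \<E> M A \<P> \<Sigma> V \<and> fixed_outside_nbhd M Z V h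
        \<longrightarrow> h \<in> \<E>_id M A \<P> \<Sigma> V 0)
     \<and>
     (\<exists>(M :: complex topology) (A :: (complex, complex) chart set) \<P> \<Sigma> Z V h.
        smooth_manifold M A \<and> singular_partition M \<P> \<Sigma> \<and>
        closedin M Z \<and> (\<forall>z\<in>Z. {z} \<in> \<Sigma>) \<and>
        invariant_contraction M A \<P> \<Sigma> \<infinity> Z V \<and>
        h \<in> \<E> M A \<P> \<Sigma> V \<and> fixed_outside_nbhd M Z V h \<and>
        (\<exists>r\<ge>1. h \<notin> \<E>_id M A \<P> \<Sigma> V r))"
proof (intro conjI allI impI)
  fix M :: "'a topology" and A :: "('a, 'b) chart set" and \<P> \<Sigma> Z V h
  assume "smooth_manifold M A \<and> singular_partition M \<P> \<Sigma> \<and>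
        closedin M Z \<and> (\<forall>z\<in>Z. {z} \<in> \<Sigma>) \<and>
        invariant_contraction M A \<P> \<Sigma> \<infinity> Z V \<and>
        h \<in> \<E> M A \<P> \<Sigma> V \<and> fixed_outside_nbhd M Z V h"
  then show "h \<in> \<E>_id M A \<P> \<Sigma> V 0"
    by (elim conjE) (rule fixed_outside_in_\<E>_id)
next
  show "\<exists>(M :: complex topology) (A :: (complex, complex) chart set) \<P> \<Sigma> Z V h.
        smooth_manifold M A \<and> singular_partition M \<P> \<Sigma> \<and>
        closedin M Z \<and> (\<forall>z\<in>Z. {z} \<in> \<Sigma>) \<and>
        invariant_contraction M A \<P> \<Sigma> \<infinity> Z V \<and>
        h \<in> \<E> M A \<P> \<Sigma> V \<and> fixed_outside_nbhd M Z V h \<and>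
        (\<exists>r\<ge>1. h \<notin> \<E>_id M A \<P> \<Sigma> V r)"
  proof (intro exI conjI)
    show "smooth_manifold (euclidean :: complex topology) euclidean_atlas" by (rule smooth_manifold_euclidean)
    show "singular_partition euclidean levels {{0}}" by (rule singular_partition_levels)
    show "invariant_contraction euclidean euclidean_atlas levels {{0}} \<infinity> {0} disc"
      by (rule invariant_contraction_disc)
    show "restrict twist disc \<in> \<E> euclidean euclidean_atlas levels {{0}} disc" by (rule twist_in_\<E>)
    show "fixed_outside_nbhd euclidean {0} disc (restrict twist disc)" by (rule twist_fixed_outside)
    show "restrict twist disc \<notin> \<E>_id euclidean euclidean_atlas levels {{0}} disc 1" by (rule twist_notin_\<E>_id)
  qed simp_all
qed

end
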